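(* Let $q_1,q_2$ be integers with $1\le q_1\le q_2$, $A=\begin{pmatrix}3q_1&0\\0&3q_2\end{pmatrix}$, $\mathcal{D}=\left\{\begin{pmatrix}0\\0\end{pmatrix},\begin{pmatrix}1\\0\end{pmatrix},\begin{pmatrix}0\\1\end{pmatrix}\right\}$, and $\mu_{A,\mathcal{D}}$ the associated Sierpiński-type measure. For any $t\in\left[0,\frac{\log3}{\log 3q_2}\right]$ there exist uncountably many spectra $\Lambda_t$ of $\mu_{A,\mathcal{D}}$ with $\dim_{Be}(\Lambda_t)=t$.
   Context: $\mu_{A,\mathcal{D}}$ is the unique Borel probability measure on $\mathbb{R}^2$ with $\mu_{A,\mathcal{D}}(E)=\frac13\sum_{d\in\mathcal{D}}\mu_{A,\mathcal{D}}(AE-d)$ for Borel $E$. A countable $\Lambda\subseteq\mathbb{R}^2$ is a spectrum of $\mu$ if $\{e^{-2\pi i\langle\lambda,x\rangle}:\lambda\in\Lambda\}$ is an orthonormal basis of $L^2(\mu)$. For countable $\Lambda\subseteq\mathbb{R}^d$ and $r>0$, $D_r^+(\Lambda)=\limsup_{h\to\infty}\sup_{x\in\mathbb{R}^d}\#(\Lambda\cap B(x,h))/h^r$ ($B(x,h)$ the open ball), and $\dim_{Be}(\Lambda)=\inf\{r:D_r^+(\Lambda)=0\}$. *)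

theory Defs
  imports "HOL-Probability.Probability"
begin

definition sier_A :: "int \<Rightarrow> int \<Rightarrow> real \<times> real \<Rightarrow> real \<times> real" where
  "sier_A q1 q2 x = (3 * real_of_int q1 * fst x, 3 * real_of_int q2 * snd x)"

definition sier_D :: "(real \<times> real) set" where
  "sier_D = {(0, 0), (1, 0), (0, 1)}"

definition self_affine_measure ::
  "((real \<times> real) \<Rightarrow> (real \<times> real)) \<Rightarrow> (real \<times> real) set \<Rightarrow> (real \<times> real) measure \<Rightarrow> bool" where
  "self_affine_measure A D \<mu> \<longleftrightarrow>
     prob_space \<mu> \<and> sets \<mu> = sets borel \<and>
     (\<forall>E \<in> sets borel. measure \<mu> E =
        (1 / real (card D)) * (\<Sum>d\<in>D. measure \<mu> ((\<lambda>x. A x - d) ` E)))"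

definition expo :: "real \<times> real \<Rightarrow> real \<times> real \<Rightarrow> complex" where
  "expo l x = exp (- 2 * pi * \<i> * complex_of_real (l \<bullet> x))"

definition L2 :: "'a measure \<Rightarrow> ('a \<Rightarrow> complex) \<Rightarrow> bool" where
  "L2 M f \<longleftrightarrow> f \<in> borel_measurable M \<and> integrable M (\<lambda>x. (cmod (f x))\<^sup>2)"

definition L2_inner :: "'a measure \<Rightarrow> ('a \<Rightarrow> complex) \<Rightarrow> ('a \<Rightarrow> complex) \<Rightarrow> complex" where
  "L2_inner M f g = (LINT x|M. f x * cnj (g x))"

text \<open>Lambda is a spectrum: countable, and {e_lambda} is an orthonormal basis of L^2(mu),
  i.e. an orthonormal system whose orthogonal complement in L^2(mu) is trivial.\<close>
definition is_spectrum :: "(real \<times> real) measure \<Rightarrow> (real \<times> real) set \<Rightarrow> bool" where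
  "is_spectrum \<mu> \<Lambda> \<longleftrightarrow>
     countable \<Lambda> \<and>
     (\<forall>l\<in>\<Lambda>. \<forall>l'\<in>\<Lambda>. L2_inner \<mu> (expo l) (expo l') = (if l = l' then 1 else 0)) \<and>
     (\<forall>f. L2 \<mu> f \<longrightarrow> (\<forall>l\<in>\<Lambda>. L2_inner \<mu> f (expo l) = 0) \<longrightarrow> (AE x in \<mu>. f x = 0))"

definition ecount :: "'a set \<Rightarrow> ereal" where
  "ecount S = (if finite S then ereal (real (card S)) else \<infinity>)"

definition upper_beurling_density :: "'a::metric_space set \<Rightarrow> real \<Rightarrow> ereal" where
  "upper_beurling_density \<Lambda> r =
     Limsup at_top (\<lambda>h::real. SUP x. ecount (\<Lambda> \<inter> ball x h) / ereal (h powr r))"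

text \<open>Beurling dimension: inf { r > 0 : D_r^+(Lambda) = 0 } (= infinity if empty).\<close>
definition beurling_dim :: "'a::metric_space set \<Rightarrow> ereal" where
  "beurling_dim \<Lambda> = Inf (ereal ` {r. r > 0 \<and> upper_beurling_density \<Lambda> r = 0})"

end

theory Submission
  imports Defs
begin

text \<open>
  Write \<open>A = diag (b1, b2)\<close> with \<open>bi = 3 qi\<close>. The Fourier transform of \<open>\<mu>\<close> is the infinite product of
  \<open>m (A^-k \<xi>)\<close>, \<open>k \<ge> 1\<close>, for the mask \<open>m (s, t) = (1 + e(-s) + e(-t)) / 3\<close>, and the squared moduli of the mask
  at the translates by \<open>(0, 0)\<close>, \<open>(-1/3, 1/3)\<close>, \<open>(1/3, 2/3)\<close> add up to 1. Hence a tree of frequencies in which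
  the three children of a node at level \<open>n\<close> differ by the vectors \<open>A^n (0, 0)\<close>, \<open>A^n (-q1, q2)\<close>,
  \<open>A^n (q1, 2 q2)\<close> satisfies Parseval's identity for every finite product, whatever common integral
  shift each triple of siblings receives. The nodes are numbered by their base 3 expansions.

  The only shifts used are \<open>A^j (0, 1)\<close>, applied at level \<open>j\<close> along the branch \<open>j000...\<close>, for all
  \<open>j\<close> outside a set \<open>W\<close>. At each level at most one shift of a node is still pending. Since all zeros of
  the Fourier transform have first coordinate of modulus at least 1, it is bounded below at the rescaled
  frequencies, and dominated convergence carries Parseval's identity over to \<open>\<mu>\<close>.

  For \<open>W\<close> take the numbers whose nonzero digits sit at positions in a set \<open>S\<close> of density
  \<open>t ln b2 / ln 3\<close>. The frequencies in \<open>W\<close> have Beurling dimension \<open>t\<close>, the other ones are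
  lacunary and do not contribute. Translating the resulting spectrum gives uncountably many.
\<close>

section \<open>Uniqueness of Fourier transforms\<close>

text \<open>Levy's uniqueness theorem concerns probability measures, so the signed \<open>g\<close>
  is written as \<open>Z\<close> times the difference of two probability densities. The summand 1 in
  \<open>w\<close> keeps \<open>Z\<close> positive even when \<open>g\<close> vanishes.\<close>

lemma (in prob_space) fourier_zero_imp_set_integral_zero_real:
  fixes g X :: "'a \<Rightarrow> real"
  assumes g: "integrable M g" and X [measurable]: "X \<in> borel_measurable M"
    and zero: "\<And>s. (LINT x|M. g x *\<^sub>R iexp (s * X x)) = 0"
    and E [measurable]: "E \<in> sets borel"
  shows "(LINT x|M. indicator E (X x) * g x) = 0"
proof -
  note [measurable] = borel_measurable_integrable[OF g]
  \<comment> \<open>The probability densities \<open>w / Z\<close> and \<open>(w + g) / Z\<close> give \<open>X\<close> the same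
    characteristic function.\<close>
  define w where "w x = 1 + \<bar>g x\<bar>" for x
  have w: "integrable M w" unfolding w_def using g by auto
  note [measurable] = borel_measurable_integrable[OF w]
  have g0: "(LINT x|M. g x) = 0"
  proof -
    have "complex_of_real (LINT x|M. g x) = 0"
      using zero[of 0] g by (simp add: scaleR_conv_of_real)
    thus ?thesis by simp
  qed
  define Z where "Z = (LINT x|M. w x)"
  have "(LINT x|M. 1) \<le> Z" unfolding Z_def
    by (rule integral_mono) (use w in \<open>auto simp: w_def\<close>)
  hence Z: "Z > 0" by (simp add: prob_space)
  define N where "N p = distr (density M (\<lambda>x. ennreal (p x))) borel X" for p :: "'a \<Rightarrow> real"
  have N: "real_distribution (N p)" "char (N p) s = (LINT x|M. p x *\<^sub>R iexp (s * X x))"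
      "measure (N p) E = (LINT x|M. indicator E (X x) * p x)"
    if p: "integrable M p" "\<And>x. 0 \<le> p x" "(LINT x|M. p x) = 1" for p s
  proof -
    note [measurable] = borel_measurable_integrable[OF p(1)]
    have "emeasure (density M (\<lambda>x. ennreal (p x))) (space M) = (\<integral>\<^sup>+x. ennreal (p x) \<partial>M)"
      by (subst emeasure_density) (auto intro!: nn_integral_cong)
    also have "\<dots> = 1" using p by (subst nn_integral_eq_integral) auto
    finally have P: "prob_space (density M (\<lambda>x. ennreal (p x)))"
      by (intro prob_spaceI) simp
    interpret P: prob_space "density M (\<lambda>x. ennreal (p x))" by fact
    interpret R: real_distribution "N p"
      unfolding N_def by (rule P.real_distribution_distr) simp
    show "real_distribution (N p)" ..
    show "char (N p) s = (LINT x|M. p x *\<^sub>R iexp (s * X x))"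
      unfolding char_def N_def using p by (simp add: integral_distr integral_density)
    have "measure (N p) E = (LINT x|N p. indicator E x)" by (simp add: N_def)
    also have "\<dots> = (LINT x|M. p x *\<^sub>R indicator E (X x))"
      unfolding N_def using p by (subst integral_distr) (simp_all add: integral_density)
    finally show "measure (N p) E = (LINT x|M. indicator E (X x) * p x)"
      by (simp add: mult.commute)
  qed
  have w0: "0 \<le> w x" "0 \<le> w x + g x" for x by (auto simp: w_def)
  define p1 where "p1 x = w x / Z" for x
  define p2 where "p2 x = (w x + g x) / Z" for x
  have p1: "integrable M p1" "\<And>x. 0 \<le> p1 x" "(LINT x|M. p1 x) = 1"
    using w Z w0 unfolding p1_def by (simp_all flip: Z_def)
  have p2: "integrable M p2" "\<And>x. 0 \<le> p2 x" "(LINT x|M. p2 x) = 1"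
    using w g Z g0 w0 unfolding p2_def by (simp_all flip: Z_def)
  have iexp_int: "integrable M (\<lambda>x. p x *\<^sub>R iexp (s * X x))" if "integrable M p" for p s
  proof (rule Bochner_Integration.integrable_bound[OF that])
    note [measurable] = borel_measurable_integrable[OF that]
    show "(\<lambda>x. p x *\<^sub>R iexp (s * X x)) \<in> borel_measurable M" by measurable
  qed auto
  have "char (N p1) = char (N p2)"
  proof
    fix s
    have "char (N p2) s = (LINT x|M. p1 x *\<^sub>R iexp (s * X x) + (1/Z) *\<^sub>R (g x *\<^sub>R iexp (s * X x)))"
      unfolding N(2)[OF p2] by (intro Bochner_Integration.integral_cong)
        (auto simp: p1_def p2_def add_divide_distrib scaleR_add_left)
    also have "\<dots> = char (N p1) s"
      unfolding N(2)[OF p1]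
      by (subst Bochner_Integration.integral_add[OF iexp_int[OF p1(1)]
            integrable_scaleR_right[OF iexp_int[OF g]]], subst integral_scaleR_right)
        (simp_all only: zero scaleR_zero_right add_0_right)
    finally show "char (N p1) s = char (N p2) s" ..
  qed
  hence "N p1 = N p2" by (rule Levy_uniqueness[OF N(1)[OF p1] N(1)[OF p2]])
  hence eq: "(LINT x|M. indicator E (X x) * p1 x) = (LINT x|M. indicator E (X x) * p2 x)"
    using N(3)[OF p1] N(3)[OF p2] by simp
  have ind: "integrable M (\<lambda>x. indicator E (X x) * p x)" if "integrable M p" for p :: "'a \<Rightarrow> real"
  proof (rule Bochner_Integration.integrable_bound[OF that])
    note [measurable] = borel_measurable_integrable[OF that]
    show "(\<lambda>x. indicator E (X x) * p x) \<in> borel_measurable M" by measurable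
  qed (auto simp: indicator_def)
  have "(LINT x|M. indicator E (X x) * g x)
      = (LINT x|M. Z * (indicator E (X x) * p2 x - indicator E (X x) * p1 x))"
    using Z by (intro Bochner_Integration.integral_cong)
      (auto simp: p1_def p2_def field_simps)
  also have "\<dots> = Z * ((LINT x|M. indicator E (X x) * p2 x) - (LINT x|M. indicator E (X x) * p1 x))"
    by (simp add: ind p1 p2)
  finally show ?thesis using eq by simp
qed

text \<open>Conjugating the hypothesis at \<open>-s\<close> gives it for the conjugate of
  \<open>g\<close>. Hence it holds for the real and the imaginary part, and the real case applies to
  each.\<close>

lemma (in prob_space) fourier_zero_imp_set_integral_zero:
  fixes g :: "'a \<Rightarrow> complex" and X :: "'a \<Rightarrow> real"
  assumes g: "integrable M g" and X [measurable]: "X \<in> borel_measurable M"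
    and zero: "\<And>s. (LINT x|M. g x * iexp (s * X x)) = 0"
    and E [measurable]: "E \<in> sets borel"
  shows "(LINT x|M. indicator E (X x) *\<^sub>R g x) = 0"
proof -
  note [measurable] = borel_measurable_integrable[OF g]
  have int: "integrable M (\<lambda>x. g x * iexp (s * X x))" for s
    by (rule Bochner_Integration.integrable_bound[OF g]) (auto simp: norm_mult)
  have intE: "integrable M (\<lambda>x. indicator E (X x) *\<^sub>R g x)"
    by (rule Bochner_Integration.integrable_bound[OF g]) (auto simp: indicator_def)
  have cnj0: "(LINT x|M. cnj (g x) * iexp (s * X x)) = 0" for s
  proof -
    have "(LINT x|M. cnj (g x) * iexp (s * X x)) = (LINT x|M. cnj (g x * iexp ((-s) * X x)))"
      by (intro Bochner_Integration.integral_cong) (auto simp: exp_cnj)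
    also have "\<dots> = cnj (LINT x|M. g x * iexp ((-s) * X x))" by (rule Bochner_Integration.integral_cnj)
    also have "\<dots> = 0" unfolding zero by simp
    finally show ?thesis .
  qed
  have [measurable]: "(\<lambda>x. cnj (g x)) \<in> borel_measurable M"
    using g by (intro borel_measurable_integrable) simp
  have intc: "integrable M (\<lambda>x. cnj (g x) * iexp (s * X x))" for s
    by (rule Bochner_Integration.integrable_bound[OF g]) (auto simp: norm_mult)
  have re: "(LINT x|M. Re (g x) *\<^sub>R iexp (s * X x)) = 0" for s
  proof -
    have "(LINT x|M. Re (g x) *\<^sub>R iexp (s * X x))
        = (LINT x|M. (g x * iexp (s * X x) + cnj (g x) * iexp (s * X x)) / 2)"
      by (intro Bochner_Integration.integral_cong)
        (auto simp: complex_add_cnj scaleR_conv_of_real simp flip: distrib_right)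
    also have "\<dots> = 0" using int intc zero cnj0 by simp
    finally show ?thesis .
  qed
  have im: "(LINT x|M. Im (g x) *\<^sub>R iexp (s * X x)) = 0" for s
  proof -
    have "(LINT x|M. Im (g x) *\<^sub>R iexp (s * X x))
        = (LINT x|M. (g x * iexp (s * X x) - cnj (g x) * iexp (s * X x)) / (2 * \<i>))"
      by (intro Bochner_Integration.integral_cong)
        (auto simp: complex_diff_cnj scaleR_conv_of_real field_simps simp flip: left_diff_distrib)
    also have "\<dots> = 0" using int intc zero cnj0 by simp
    finally show ?thesis .
  qed
  show ?thesis
  proof (rule complex_eqI)
    have "Re (LINT x|M. indicator E (X x) *\<^sub>R g x) = (LINT x|M. indicator E (X x) * Re (g x))"
      using intE by (subst integral_Re[symmetric]) auto
    also have "\<dots> = 0"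
      using re by (intro fourier_zero_imp_set_integral_zero_real) (auto simp: g)
    finally show "Re (LINT x|M. indicator E (X x) *\<^sub>R g x) = Re 0" by simp
    have "Im (LINT x|M. indicator E (X x) *\<^sub>R g x) = (LINT x|M. indicator E (X x) * Im (g x))"
      using intE by (subst integral_Im[symmetric]) auto
    also have "\<dots> = 0"
      using im by (intro fourier_zero_imp_set_integral_zero_real) (auto simp: g)
    finally show "Im (LINT x|M. indicator E (X x) *\<^sub>R g x) = Im 0" by simp
  qed
qed

lemma expo_measurable [measurable]: "expo l \<in> borel_measurable borel"
  unfolding expo_def by measurable

lemma cmod_expo [simp]: "cmod (expo l x) = 1"
  unfolding expo_def by (simp add: norm_exp_eq_Re)

lemma expo_add: "expo (l + l') x = expo l x * expo l' x"
  unfolding expo_def by (simp add: exp_add[symmetric] inner_add_left algebra_simps)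

lemma cnj_expo: "cnj (expo l x) = expo (- l) x"
  unfolding expo_def by (simp add: exp_cnj)

lemma expo_zero [simp]: "expo 0 x = 1"
  unfolding expo_def by simp

text \<open>The one-dimensional statement is used twice: in the first coordinate with
  \<open>f x * iexp (b * snd x)\<close> in the role of \<open>g\<close>, then in the second with
  \<open>indicator E (fst x) *\<^sub>R f x\<close>. So \<open>f\<close> integrates to zero over all
  rectangles, and by a Dynkin class argument over all Borel sets.\<close>

lemma fourier_zero_imp_AE_zero:
  fixes M :: "(real \<times> real) measure" and f :: "real \<times> real \<Rightarrow> complex"
  assumes "prob_space M" and sets [measurable_cong]: "sets M = sets borel"
    and f: "integrable M f"
    and zero: "\<And>\<xi>. (LINT x|M. f x * cnj (expo \<xi> x)) = 0"
  shows "AE x in M. f x = 0"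
proof -
  interpret prob_space M by fact
  note [measurable] = borel_measurable_integrable[OF f]
  have space: "space M = UNIV" using sets_eq_imp_space_eq[OF sets] by simp
  have [measurable]: "fst \<in> borel_measurable M" "snd \<in> borel_measurable M"
    unfolding measurable_cong_sets[OF sets refl]
    by (auto intro!: borel_measurable_continuous_onI continuous_intros)
  have z: "(LINT x|M. (f x * iexp (b * snd x)) * iexp (a * fst x)) = 0" for a b
  proof -
    \<comment> \<open>The factor 1 / (2 pi) undoes the normalisation of \<open>expo\<close>, the
      conjugation its sign.\<close>
    have "cnj (expo (a / (2*pi), b / (2*pi)) x) = iexp (b * snd x) * iexp (a * fst x)" for x
      unfolding cnj_expo unfolding expo_def exp_add[symmetric]
      by (rule arg_cong[of _ _ exp]) (simp add: inner_prod_def field_simps)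
    thus ?thesis using zero[of "(a / (2*pi), b / (2*pi))"] by (simp add: mult.assoc)
  qed
  have z1: "(LINT x|M. indicator E (fst x) *\<^sub>R (f x * iexp (b * snd x))) = 0"
    if [measurable]: "E \<in> sets borel" for E b
  proof (rule fourier_zero_imp_set_integral_zero[OF _ _ z])
    show "integrable M (\<lambda>x. f x * iexp (b * snd x))"
      by (rule Bochner_Integration.integrable_bound[OF f]) (auto simp: norm_mult)
  qed measurable
  have z2: "(LINT x|M. indicator F (snd x) *\<^sub>R (indicator E (fst x) *\<^sub>R f x)) = 0"
    if [measurable]: "E \<in> sets borel" "F \<in> sets borel" for E F
  proof (rule fourier_zero_imp_set_integral_zero)
    show "integrable M (\<lambda>x. indicator E (fst x) *\<^sub>R f x)"
      by (rule Bochner_Integration.integrable_bound[OF f]) (auto simp: indicator_def)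
    show "(LINT x|M. indicator E (fst x) *\<^sub>R f x * iexp (s * snd x)) = 0" for s
      using z1[OF that(1), of s] by (simp add: mult.assoc)
  qed measurable
  have sI: "set_integrable M A f" if "A \<in> sets M" for A
    using that f unfolding set_integrable_def by (intro integrable_mult_indicator) auto
  define G where "G = {E \<times> F | E F. E \<in> sets (borel::real measure) \<and> F \<in> sets (borel::real measure)}"
  have "sets M = sets ((borel :: real measure) \<Otimes>\<^sub>M (borel :: real measure))" unfolding sets by (subst borel_prod) (rule refl)
  also have "\<dots> = sigma_sets UNIV G" unfolding G_def by (simp add: sets_pair_measure)
  finally have M_G: "sets M = sigma_sets UNIV G" .
  have "(LINT x:A|M. f x) = 0" if A: "A \<in> sets M" for A
  proof -
    have "Int_stable G" unfolding G_def by (rule Int_stable_pair_measure_generator)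
    moreover have "G \<subseteq> Pow UNIV" by simp
    moreover have "A \<in> sigma_sets UNIV G" using A M_G by simp
    ultimately show ?thesis
    proof (induction rule: sigma_sets_induct_disjoint)
      case (basic A)
      then obtain E F where EF: "A = E \<times> F" "E \<in> sets borel" "F \<in> sets borel"
        by (auto simp: G_def)
      show ?case using z2[OF EF(2,3)] unfolding EF(1) set_lebesgue_integral_def
        by (simp add: indicator_times mult.commute)
    next
      case empty
      show ?case by (simp add: set_lebesgue_integral_def)
    next
      case (compl A)
      have A: "A \<in> sets M" using compl(1) M_G by simp
      have "(LINT x:UNIV - A|M. f x) + (LINT x:A|M. f x) = (LINT x:UNIV|M. f x)"
        using A sets.compl_sets[OF A] space
        by (subst set_integral_Un[symmetric]) (auto intro!: sI)
      moreover have "(LINT x:UNIV|M. f x) = 0"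
        using z2[of UNIV UNIV] by (simp add: set_lebesgue_integral_def)
      ultimately show ?case using compl(2) by simp
    next
      case (union A)
      have A: "A i \<in> sets M" for i using union(2) M_G by auto
      have "(LINT x:(\<Union>i. A i)|M. f x) = (\<Sum>i. LINT x:A i|M. f x)"
        using union(1) A
        by (intro lebesgue_integral_countable_add sI sets.countable_UN) (auto simp: disjoint_family_on_def)
      thus ?case using union(3) by simp
    qed
  qed
  hence "AE x in M. f x = (\<lambda>_. 0) x"
    by (intro density_unique_banach f) (auto simp: set_lebesgue_integral_def)
  thus ?thesis by simp
qed

section \<open>Spectra and their translates\<close>

lemma L2_inner_expo_translate:
  "L2_inner M f (expo (v + l)) = L2_inner M (\<lambda>x. f x * cnj (expo v x)) (expo l)"
  unfolding L2_inner_def by (simp add: expo_add mult.assoc)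

lemma L2_inner_expo_expo: "L2_inner M (expo l) (expo l') = (LINT x|M. expo (l - l') x)"
  unfolding L2_inner_def by (simp add: cnj_expo flip: expo_add)

text \<open>The sums in \<open>approx\<close> come arbitrarily close to the squared norm 1 of
  \<open>expo \<xi>\<close>, so every exponential is a limit of finite combinations of exponentials
  from \<Lambda>. A function orthogonal to the latter is then orthogonal to all exponentials, and
  uniqueness of Fourier transforms makes it vanish.\<close>

lemma is_spectrumI:
  fixes M :: "(real \<times> real) measure"
  assumes "prob_space M" and sets [measurable_cong]: "sets M = sets borel" and "countable \<Lambda>"
    and orth: "\<And>l l'. l \<in> \<Lambda> \<Longrightarrow> l' \<in> \<Lambda> \<Longrightarrow> l \<noteq> l' \<Longrightarrow> L2_inner M (expo l) (expo l') = 0"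
    and approx: "\<And>\<xi> e. e > 0 \<Longrightarrow> \<exists>F\<subseteq>\<Lambda>. finite F \<and>
      1 - e \<le> (\<Sum>l\<in>F. (cmod (L2_inner M (expo \<xi>) (expo l)))\<^sup>2)"
  shows "is_spectrum M \<Lambda>"
proof -
  interpret prob_space M by fact
  have [measurable]: "expo l \<in> borel_measurable M" for l
    unfolding measurable_cong_sets[OF sets refl] by (rule expo_measurable)
  have [measurable]: "cnj \<in> borel_measurable borel"
    by (intro borel_measurable_continuous_onI continuous_intros)
  have expo_int [simp]: "integrable M (expo l)" for l
    by (rule integrable_const_bound[of _ 1]) auto
  have orthonormal: "L2_inner M (expo l) (expo l') = (if l = l' then 1 else 0)"
    if "l \<in> \<Lambda>" "l' \<in> \<Lambda>" for l l'
    using orth[OF that] by (auto simp: L2_inner_expo_expo prob_space)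
  have complete: "AE x in M. f x = 0"
    if f: "L2 M f" and f0: "\<And>l. l \<in> \<Lambda> \<Longrightarrow> L2_inner M f (expo l) = 0" for f
  proof -
    have [measurable]: "f \<in> borel_measurable M" and f2: "integrable M (\<lambda>x. (cmod (f x))\<^sup>2)"
      using f by (auto simp: L2_def)
    \<comment> \<open>On a probability space this makes \<open>f\<close> integrable, as the
      uniqueness result requires.\<close>
    have f_le: "cmod (f x) \<le> 1 + (cmod (f x))\<^sup>2" for x
    proof -
      have "0 \<le> (cmod (f x) - 1)\<^sup>2" by simp
      hence "2 * cmod (f x) \<le> 1 + (cmod (f x))\<^sup>2" by (simp add: power2_diff)
      thus ?thesis using norm_ge_zero[of "f x"] by linarith
    qed
    have fi: "integrable M f"
    proof (rule Bochner_Integration.integrable_bound)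
      show "integrable M (\<lambda>x. 1 + (cmod (f x))\<^sup>2)" using f2 by simp
      show "AE x in M. norm (f x) \<le> norm (1 + (cmod (f x))\<^sup>2)"
        unfolding real_norm_def by (intro AE_I2 order_trans[OF f_le abs_ge_self])
    qed measurable
    have fe: "integrable M (\<lambda>x. f x * cnj (expo l x))" for l
      unfolding cnj_expo
      by (rule Bochner_Integration.integrable_bound[OF fi]) (auto simp: norm_mult)
    have "L2_inner M f (expo \<xi>) = 0" for \<xi>
    proof -
      define K where "K = (LINT x|M. (cmod (f x))\<^sup>2)"
      have K: "K \<ge> 0" unfolding K_def by simp
      have bound: "cmod (L2_inner M f (expo \<xi>)) \<le> d * ((K + 1) / 2)" if d: "d > 0" for d
      proof -
        obtain F where F: "F \<subseteq> \<Lambda>" "finite F"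
            "1 - d\<^sup>2 \<le> (\<Sum>l\<in>F. (cmod (L2_inner M (expo \<xi>) (expo l)))\<^sup>2)"
          using approx[of "d\<^sup>2" \<xi>] d by auto
        define c where "c l = L2_inner M (expo \<xi>) (expo l)" for l
        \<comment> \<open>The residual of the orthogonal projection of \<open>expo \<xi>\<close> to
          the span of \<open>F\<close>. By orthonormality its squared norm is 1 minus the sum of the
          squared moduli of the coefficients, hence at most \<open>d\<^sup>2\<close>.\<close>
        define g where "g x = expo \<xi> x - (\<Sum>l\<in>F. c l * expo l x)" for x
        have [measurable]: "g \<in> borel_measurable M" unfolding g_def by measurable
        have c_int: "(LINT x|M. expo (\<xi> - l) x) = c l" for l
          unfolding c_def L2_inner_expo_expo ..
        have c_int': "(LINT x|M. expo (l - \<xi>) x) = cnj (c l)" for l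
        proof -
          have "expo (l - \<xi>) x = cnj (expo (\<xi> - l) x)" for x by (simp add: cnj_expo)
          thus ?thesis using c_int[of l] by simp
        qed
        have gg: "g x * cnj (g x) = 1 - (\<Sum>l\<in>F. cnj (c l) * expo (\<xi> - l) x)
            - (\<Sum>l\<in>F. c l * expo (l - \<xi>) x)
            + (\<Sum>l\<in>F. \<Sum>l'\<in>F. c l * cnj (c l') * expo (l - l') x)" for x
        proof -
          have e: "expo a x * cnj (expo b x) = expo (a - b) x" for a b
            by (simp add: cnj_expo flip: expo_add)
          have "g x * cnj (g x) = expo \<xi> x * cnj (expo \<xi> x)
            - (\<Sum>l\<in>F. cnj (c l) * (expo \<xi> x * cnj (expo l x)))
            - (\<Sum>l\<in>F. c l * (expo l x * cnj (expo \<xi> x)))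
            + (\<Sum>l\<in>F. \<Sum>l'\<in>F. c l * cnj (c l') * (expo l x * cnj (expo l' x)))"
            unfolding g_def complex_cnj_diff cnj_sum complex_cnj_mult ring_distribs sum_product
            by (simp add: sum_distrib_left sum_distrib_right mult_ac)
          thus ?thesis unfolding e by simp
        qed
        have gg_int: "integrable M (\<lambda>x. g x * cnj (g x))" unfolding gg by simp
        have "(LINT x|M. g x * cnj (g x)) = 1 - (\<Sum>l\<in>F. cnj (c l) * c l) - (\<Sum>l\<in>F. c l * cnj (c l))
            + (\<Sum>l\<in>F. \<Sum>l'\<in>F. c l * cnj (c l') * (LINT x|M. expo (l - l') x))"
          unfolding gg by (simp add: prob_space c_int c_int')
        also have "(\<Sum>l\<in>F. \<Sum>l'\<in>F. c l * cnj (c l') * (LINT x|M. expo (l - l') x))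
            = (\<Sum>l\<in>F. \<Sum>l'\<in>F. if l = l' then c l * cnj (c l') else 0)"
        proof (intro sum.cong refl)
          fix l l' assume "l \<in> F" "l' \<in> F"
          hence "(LINT x|M. expo (l - l') x) = (if l = l' then 1 else 0)"
            using F(1) orthonormal unfolding L2_inner_expo_expo[symmetric] by blast
          thus "c l * cnj (c l') * (LINT x|M. expo (l - l') x) = (if l = l' then c l * cnj (c l') else 0)"
            by simp
        qed
        also have "\<dots> = (\<Sum>l\<in>F. c l * cnj (c l))" using F(2) by simp
        finally have "(LINT x|M. g x * cnj (g x)) = 1 - (\<Sum>l\<in>F. c l * cnj (c l))"
          by (simp add: mult.commute)
        hence "(LINT x|M. complex_of_real ((cmod (g x))\<^sup>2)) = complex_of_real (1 - (\<Sum>l\<in>F. (cmod (c l))\<^sup>2))"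
          by (simp flip: complex_norm_square)
        hence g2: "(LINT x|M. (cmod (g x))\<^sup>2) = 1 - (\<Sum>l\<in>F. (cmod (c l))\<^sup>2)"
          unfolding integral_complex_of_real by (simp only: of_real_eq_iff)
        have g2_int: "integrable M (\<lambda>x. (cmod (g x))\<^sup>2)"
          using integrable_norm[OF gg_int] by (simp add: norm_mult power2_eq_square)
        \<comment> \<open>AM-GM in place of the Cauchy-Schwarz inequality\<close>
        have fg_le: "cmod (f x * cnj (g x)) \<le> (d * (cmod (f x))\<^sup>2 + (cmod (g x))\<^sup>2 / d) / 2" for x
        proof -
          have "0 \<le> (d * cmod (f x) - cmod (g x))\<^sup>2" by simp
          hence "2 * d * (cmod (f x) * cmod (g x)) \<le> d\<^sup>2 * (cmod (f x))\<^sup>2 + (cmod (g x))\<^sup>2"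
            by (simp add: power2_diff power_mult_distrib mult_ac)
          thus ?thesis using d by (simp add: norm_mult field_simps power2_eq_square)
        qed
        have rhs_int: "integrable M (\<lambda>x. (d * (cmod (f x))\<^sup>2 + (cmod (g x))\<^sup>2 / d) / 2)"
          using f2 g2_int by simp
        have fg_int: "integrable M (\<lambda>x. f x * cnj (g x))"
        proof (rule Bochner_Integration.integrable_bound[OF rhs_int])
          show "AE x in M. norm (f x * cnj (g x)) \<le> norm ((d * (cmod (f x))\<^sup>2 + (cmod (g x))\<^sup>2 / d) / 2)"
            unfolding real_norm_def by (intro AE_I2 order_trans[OF fg_le abs_ge_self])
        qed measurable
        \<comment> \<open>Since \<open>f\<close> is orthogonal to the exponentials of
          \<open>F\<close>, replacing \<open>expo \<xi>\<close> by its small residual leaves the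
          inner product with \<open>f\<close> unchanged.\<close>
        have "(LINT x|M. f x * cnj (g x))
            = (LINT x|M. f x * cnj (expo \<xi> x) - (\<Sum>l\<in>F. cnj (c l) * (f x * cnj (expo l x))))"
          unfolding g_def by (simp add: ring_distribs sum_distrib_left mult_ac)
        also have "\<dots> = L2_inner M f (expo \<xi>) - (\<Sum>l\<in>F. cnj (c l) * L2_inner M f (expo l))"
          unfolding L2_inner_def using fe by simp
        also have "(\<Sum>l\<in>F. cnj (c l) * L2_inner M f (expo l)) = 0"
        proof (intro sum.neutral ballI)
          fix l assume "l \<in> F"
          hence "l \<in> \<Lambda>" using F(1) by blast
          thus "cnj (c l) * L2_inner M f (expo l) = 0" by (simp add: f0)
        qed
        finally have "cmod (L2_inner M f (expo \<xi>)) = cmod (LINT x|M. f x * cnj (g x))" by simp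
        also have "\<dots> \<le> (LINT x|M. cmod (f x * cnj (g x)))" by (rule integral_norm_bound)
        also have "\<dots> \<le> (LINT x|M. (d * (cmod (f x))\<^sup>2 + (cmod (g x))\<^sup>2 / d) / 2)"
          using fg_int rhs_int fg_le by (intro integral_mono integrable_norm)
        also have "\<dots> = (d * K + (LINT x|M. (cmod (g x))\<^sup>2) / d) / 2"
          using f2 g2_int by (simp add: K_def)
        also have "\<dots> \<le> (d * K + d\<^sup>2 / d) / 2"
          using F(3) d by (auto simp: g2 c_def intro!: divide_right_mono)
        finally show ?thesis using d by (simp add: power2_eq_square field_simps)
      qed
      have "cmod (L2_inner M f (expo \<xi>)) \<le> 0 + e" if e: "e > 0" for e
      proof -
        have "2 * e / (K + 1) * ((K + 1) / 2) = e" using K by (simp add: divide_simps)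
        thus ?thesis using bound[of "2 * e / (K + 1)"] K e by simp
      qed
      hence "cmod (L2_inner M f (expo \<xi>)) \<le> 0" by (rule field_le_epsilon)
      thus ?thesis by simp
    qed
    thus ?thesis
      by (intro fourier_zero_imp_AE_zero[OF \<open>prob_space M\<close> sets fi]) (simp add: L2_inner_def)
  qed
  show ?thesis unfolding is_spectrum_def using assms(3) orthonormal complete by blast
qed

text \<open>Multiplication by the unimodular function \<open>expo (- v)\<close> preserves square
  integrability and turns orthogonality to the translated exponentials into orthogonality to the
  original ones.\<close>

lemma is_spectrum_translate:
  assumes sets: "sets M = sets borel" and spec: "is_spectrum M \<Lambda>"
  shows "is_spectrum M ((+) v ` \<Lambda>)"
  unfolding is_spectrum_def
proof (intro conjI ballI allI impI)
  have [measurable]: "expo l \<in> borel_measurable M" for l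
    unfolding measurable_cong_sets[OF sets refl] by (rule expo_measurable)
  show "countable ((+) v ` \<Lambda>)" using spec by (simp add: is_spectrum_def)
  fix l l' assume "l \<in> (+) v ` \<Lambda>" "l' \<in> (+) v ` \<Lambda>"
  then obtain m m' where m: "l = v + m" "m \<in> \<Lambda>" "l' = v + m'" "m' \<in> \<Lambda>" by blast
  have "L2_inner M (expo l) (expo l') = L2_inner M (expo m) (expo m')"
    by (simp add: L2_inner_expo_expo m)
  thus "L2_inner M (expo l) (expo l') = (if l = l' then 1 else 0)"
    using spec m by (simp add: is_spectrum_def)
next
  have [measurable]: "expo l \<in> borel_measurable M" for l
    unfolding measurable_cong_sets[OF sets refl] by (rule expo_measurable)
  fix f assume f: "L2 M f" and 0: "\<forall>l\<in>(+) v ` \<Lambda>. L2_inner M f (expo l) = 0"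
  define h where "h x = f x * expo (- v) x" for x
  have [measurable]: "f \<in> borel_measurable M" using f by (simp add: L2_def)
  have "h \<in> borel_measurable M" unfolding h_def by measurable
  hence "L2 M h"
    using f by (simp add: L2_def h_def norm_mult)
  moreover have "\<forall>l\<in>\<Lambda>. L2_inner M h (expo l) = 0"
    using 0 by (simp add: h_def[abs_def] L2_inner_expo_translate cnj_expo)
  ultimately have "AE x in M. h x = 0" using spec by (auto simp: is_spectrum_def)
  moreover have "expo (- v) x \<noteq> 0" for x using cmod_expo[of "-v" x] by force
  ultimately show "AE x in M. f x = 0" by (simp add: h_def)
qed

lemma ecount_inj_image:
  assumes "inj_on f S" shows "ecount (f ` S) = ecount S"
  using assms by (simp add: ecount_def card_image finite_image_iff)

text \<open>The supremum runs over all centres, so a translation only reindexes it.\<close>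

lemma upper_beurling_density_translate:
  fixes \<Lambda> :: "'a::real_normed_vector set"
  shows "upper_beurling_density ((+) v ` \<Lambda>) r = upper_beurling_density \<Lambda> r"
proof -
  have "(+) v ` \<Lambda> \<inter> ball x h = (+) v ` (\<Lambda> \<inter> ball (x - v) h)" for x h
    by (auto simp: dist_norm algebra_simps)
  hence eq: "ecount ((+) v ` \<Lambda> \<inter> ball x h) = ecount (\<Lambda> \<inter> ball (x - v) h)" for x h
    by (simp add: ecount_inj_image)
  have surj: "surj (\<lambda>x. x - v)" by (rule surjI[of _ "\<lambda>x. x + v"]) simp
  have "(SUP x. ecount ((+) v ` \<Lambda> \<inter> ball x h) / ereal (h powr r))
      = (SUP x. ecount (\<Lambda> \<inter> ball x h) / ereal (h powr r))" for h
  proof -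
    have "(SUP x. ecount (\<Lambda> \<inter> ball x h) / ereal (h powr r))
       = (SUP x\<in>range (\<lambda>x. x - v). ecount (\<Lambda> \<inter> ball x h) / ereal (h powr r))"
      by (simp only: surj)
    also have "\<dots> = (SUP x. ecount (\<Lambda> \<inter> ball (x - v) h) / ereal (h powr r))"
      by (simp only: image_image)
    finally show ?thesis by (simp only: eq)
  qed
  thus ?thesis by (simp add: upper_beurling_density_def)
qed

text \<open>The translates of one spectrum cover the plane. Each spectrum is countable, so countably
  many of them would make the plane countable.\<close>

lemma uncountable_spectra_if_spectrum:
  fixes M :: "(real \<times> real) measure"
  assumes "sets M = sets borel" and spec: "is_spectrum M \<Lambda>" and ne: "\<Lambda> \<noteq> {}"
  shows "uncountable {\<Lambda>'. is_spectrum M \<Lambda>' \<and> beurling_dim \<Lambda>' = beurling_dim \<Lambda>}"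
    (is "uncountable ?S")
proof
  assume "countable ?S"
  moreover have "countable \<Lambda>'" if "\<Lambda>' \<in> ?S" for \<Lambda>' using that by (simp add: is_spectrum_def)
  ultimately have "countable (\<Union>\<Lambda>'\<in>?S. \<Lambda>')" by (intro countable_UN)
  hence "countable (\<Union>?S)" by simp
  moreover have "\<Union>?S = UNIV"
  proof (rule UNIV_eq_I[symmetric])
    fix x :: "real \<times> real"
    obtain l where l: "l \<in> \<Lambda>" using ne by auto
    have "(+) (x - l) ` \<Lambda> \<in> ?S"
      using is_spectrum_translate[OF assms(1,2)]
      by (simp add: beurling_dim_def upper_beurling_density_translate)
    moreover have "x \<in> (+) (x - l) ` \<Lambda>" using l by (intro image_eqI[of _ _ l]) auto
    ultimately show "x \<in> \<Union>?S" by blast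
  qed
  ultimately have "countable (UNIV :: (real \<times> real) set)" by simp
  hence "countable (range (fst :: real \<times> real \<Rightarrow> real))" by (rule countable_image)
  thus False using uncountable_UNIV_real by simp
qed

section \<open>Base 3 digits and the frequency tree\<close>

definition tdigit :: "nat \<Rightarrow> nat \<Rightarrow> nat" where
  "tdigit k j = j div 3 ^ k mod 3"

lemma tdigit_le: "tdigit k j \<le> 2"
  unfolding tdigit_def using mod_less_divisor[of 3 "j div 3 ^ k"] by linarith

lemma tdigit_eq_0: "j < 3 ^ n \<Longrightarrow> n \<le> k \<Longrightarrow> tdigit k j = 0"
  unfolding tdigit_def using power_increasing[of n k "3::nat"] by (simp add: div_less order_less_le_trans)

lemma tdigit_add_low: "k < n \<Longrightarrow> tdigit k (i + d * 3 ^ n) = tdigit k i"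
proof -
  assume "k < n"
  then obtain m where n: "n = k + Suc m" by (metis less_imp_Suc_add add_Suc_right)
  have "i + d * 3 ^ n = i + d * 3 ^ m * 3 * 3 ^ k" by (simp add: n power_add)
  hence "(i + d * 3 ^ n) div 3 ^ k = (i + d * 3 ^ m * 3 * 3 ^ k) div 3 ^ k" by (simp only:)
  also have "\<dots> = d * 3 ^ m * 3 + i div 3 ^ k" by (rule div_mult_self1) simp
  also have "\<dots> = i div 3 ^ k + d * 3 ^ m * 3" by (rule add.commute)
  finally show ?thesis unfolding tdigit_def by (simp only: mod_mult_self1)
qed

lemma tdigit_add_top: "i < 3 ^ n \<Longrightarrow> d < 3 \<Longrightarrow> tdigit n (i + d * 3 ^ n) = d"
  unfolding tdigit_def by simp

lemma tdigit_mod: "tdigit k (j mod 3 ^ n) = (if k < n then tdigit k j else 0)"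
proof (cases "k < n")
  case True
  have "tdigit k (j mod 3 ^ n) = tdigit k (j mod 3 ^ n + (j div 3 ^ n) * 3 ^ n)"
    by (rule tdigit_add_low[OF True, symmetric])
  also have "j mod 3 ^ n + (j div 3 ^ n) * 3 ^ n = j" by (rule mod_div_mult_eq)
  finally show ?thesis using True by simp
next
  case False
  thus ?thesis using tdigit_eq_0[of "j mod 3 ^ n" n k] by simp
qed

text \<open>A number below \<open>3 ^ Suc n\<close> is a node \<open>i\<close> of level
  \<open>n\<close> with one more leading digit \<open>d\<close>; the sum over the next level is thus
  grouped into triples of siblings.\<close>

lemma sum_lessThan_power3_Suc:
  fixes f :: "nat \<Rightarrow> 'a::comm_monoid_add"
  shows "(\<Sum>j<3 ^ Suc n. f j) = (\<Sum>i<3 ^ n. \<Sum>d<3. f (i + d * 3 ^ n))"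
proof -
  have shift: "sum f {d * 3 ^ n..<d * 3 ^ n + 3 ^ n} = (\<Sum>i<3 ^ n. f (i + d * 3 ^ n))" for d
    using sum.shift_bounds_nat_ivl[of f 0 "d * 3 ^ n" "3 ^ n"] by (simp add: add.commute atLeast0LessThan)
  have "(\<Sum>j<3 ^ Suc n. f j) = (\<Sum>d<3. sum f {d * 3 ^ n..<d * 3 ^ n + 3 ^ n})"
    by (simp add: sum.nat_group)
  also have "\<dots> = (\<Sum>d<3. \<Sum>i<3 ^ n. f (i + d * 3 ^ n))" by (simp only: shift)
  also have "(\<Sum>d<3. \<Sum>i<3 ^ n. f (i + d * 3 ^ n)) = (\<Sum>i<3 ^ n. \<Sum>d<3. f (i + d * 3 ^ n))"
    by (rule sum.swap)
  finally show ?thesis .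
qed

lemma less_power3: "j < 3 ^ j"
  by (induction j) auto

section \<open>The coordinates of the frequency tree\<close>

locale sierpinski_lattice =
  fixes q1 q2 :: int and W :: "nat set"
  assumes q1: "1 \<le> q1" and q2: "1 \<le> q2"
begin

definition b1 :: int where "b1 = 3 * q1"
definition b2 :: int where "b2 = 3 * q2"

lemma b1_ge: "3 \<le> b1" and b2_ge: "3 \<le> b2"
  using q1 q2 by (simp_all add: b1_def b2_def)

text \<open>Balanced digits keep the first coordinate at level \<open>n\<close> within half of
  \<open>b1 ^ n\<close> (\<open>xs_bound\<close>), so that after rescaling it stays away from the
  zeros of the Fourier transform.\<close>

definition sgn3 :: "nat \<Rightarrow> int" where
  "sgn3 d = (if d = 1 then -1 else if d = 2 then 1 else 0)"

text \<open>
  The shift \<open>jump k i\<close> belongs to the node \<open>i < 3 ^ k\<close> of level \<open>k\<close> and is inherited by all its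
  descendants. As \<open>j < 3 ^ j\<close>, the number \<open>j\<close> picks up its own shift only after its last nonzero digit.
\<close>

definition jump :: "nat \<Rightarrow> nat \<Rightarrow> int" where
  "jump k i = (if i = k \<and> i \<notin> W then 1 else 0)"

text \<open>\<open>xs n j\<close> and \<open>ys n j\<close> are the coordinates of the ancestor of
  \<open>j\<close> at level \<open>n\<close>: only the lowest \<open>n\<close> digits of
  \<open>j\<close> and the shifts made at levels below \<open>n\<close> enter.\<close>

definition xs :: "nat \<Rightarrow> nat \<Rightarrow> int" where
  "xs n j = (\<Sum>k<n. b1 ^ k * (q1 * sgn3 (tdigit k j)))"

definition ys :: "nat \<Rightarrow> nat \<Rightarrow> int" where
  "ys n j = (\<Sum>k<n. b2 ^ k * (q2 * int (tdigit k j) + jump k (j mod 3 ^ k)))"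

lemma xs_Suc_child:
  "i < 3 ^ n \<Longrightarrow> d < 3 \<Longrightarrow> xs (Suc n) (i + d * 3 ^ n) = xs n i + b1 ^ n * (q1 * sgn3 d)"
  unfolding xs_def by (simp add: tdigit_add_low tdigit_add_top)

lemma ys_Suc_child:
  assumes "i < 3 ^ n" "d < 3"
  shows "ys (Suc n) (i + d * 3 ^ n) = ys n i + b2 ^ n * (q2 * int d + jump n i)"
proof -
  have "(i + d * 3 ^ n) mod 3 ^ k = i mod 3 ^ k" if "k \<le> n" for k
  proof -
    have "(3::nat) ^ k dvd d * 3 ^ n" using le_imp_power_dvd[OF that, of "3::nat"] by (rule dvd_mult)
    then obtain e where "d * 3 ^ n = 3 ^ k * e" by (auto simp: dvd_def)
    thus ?thesis by (simp only: mod_mult_self2)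
  qed
  thus ?thesis using assms unfolding ys_def by (simp add: tdigit_add_low tdigit_add_top)
qed

lemma xs_stable: "j < 3 ^ n \<Longrightarrow> n \<le> m \<Longrightarrow> xs m j = xs n j"
  unfolding xs_def by (intro sum.mono_neutral_right) (auto simp: tdigit_eq_0 sgn3_def)

text \<open>From level \<open>n\<close> on all digits of \<open>j\<close> are 0 and
  \<open>j mod 3 ^ k\<close> is \<open>j\<close> itself, so the only term that can still arise is
  the shift of \<open>j\<close> at level \<open>j\<close>.\<close>

lemma ys_stable:
  assumes "j < 3 ^ n" "n \<le> m"
  shows "ys m j = ys n j + (if n \<le> j \<and> j < m \<and> j \<notin> W then b2 ^ j else 0)"
proof -
  have "ys m j = ys n j + (\<Sum>k\<in>{n..<m}. b2 ^ k * (q2 * int (tdigit k j) + jump k (j mod 3 ^ k)))"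
    unfolding ys_def lessThan_atLeast0 using assms(2) by (simp add: sum.atLeastLessThan_concat)
  also have "(\<Sum>k\<in>{n..<m}. b2 ^ k * (q2 * int (tdigit k j) + jump k (j mod 3 ^ k)))
      = (\<Sum>k\<in>{n..<m}. if k = j then (if j \<notin> W then b2 ^ j else 0) else 0)"
  proof (intro sum.cong refl)
    fix k assume k: "k \<in> {n..<m}"
    have "(3::nat) ^ n \<le> 3 ^ k" using k by (intro power_increasing) auto
    hence "j < 3 ^ k" using assms(1) by linarith
    thus "b2 ^ k * (q2 * int (tdigit k j) + jump k (j mod 3 ^ k))
      = (if k = j then (if j \<notin> W then b2 ^ j else 0) else 0)"
      using tdigit_eq_0[OF assms(1), of k] k by (simp add: jump_def)
  qed
  finally show ?thesis by simp
qed

lemma xs_bound: "2 * \<bar>xs n j\<bar> \<le> b1 ^ n"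
proof (induction n)
  case (Suc n)
  have s: "\<bar>sgn3 (tdigit n j)\<bar> \<le> 1" by (simp add: sgn3_def)
  have "2 * \<bar>xs (Suc n) j\<bar> \<le> 2 * \<bar>xs n j\<bar> + 2 * (b1 ^ n * (q1 * \<bar>sgn3 (tdigit n j)\<bar>))"
    using q1 b1_ge abs_triangle_ineq[of "xs n j" "b1 ^ n * (q1 * sgn3 (tdigit n j))"]
    by (simp add: xs_def abs_mult)
  also have "\<dots> \<le> b1 ^ n + 2 * (b1 ^ n * (q1 * 1))"
    using q1 b1_ge s Suc by (intro add_mono mult_left_mono) auto
  also have "\<dots> = b1 ^ n * (1 + 2 * q1)" by (simp add: algebra_simps)
  also have "\<dots> \<le> b1 ^ n * b1" using q1 by (intro mult_left_mono) (auto simp: b1_def)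
  finally show ?case by (simp add: mult.commute)
qed (simp add: xs_def)

lemma ys_nonneg: "0 \<le> ys n j"
  unfolding ys_def using q2 b2_ge by (intro sum_nonneg mult_nonneg_nonneg add_nonneg_nonneg) (auto simp: jump_def)

text \<open>The factor 3/2 is the least \<open>C\<close> for which
  \<open>C + (2 * q2 + 1) \<le> 3 * q2 * C\<close> holds at \<open>q2 = 1\<close>, where a step adds
  at most \<open>2 * q2 + 1\<close> times \<open>b2 ^ n\<close>.\<close>

lemma ys_bound: "2 * ys n j \<le> 3 * b2 ^ n"
proof (induction n)
  case (Suc n)
  have d: "int (tdigit n j) \<le> 2" using tdigit_le[of n j] by simp
  have b: "jump n (j mod 3 ^ n) \<le> 1" by (simp add: jump_def)
  have "2 * ys (Suc n) j = 2 * ys n j + 2 * (b2 ^ n * (q2 * int (tdigit n j) + jump n (j mod 3 ^ n)))"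
    by (simp add: ys_def)
  also have "\<dots> \<le> 3 * b2 ^ n + 2 * (b2 ^ n * (q2 * 2 + 1))"
    using q2 b2_ge d b Suc by (intro add_mono mult_left_mono) auto
  also have "\<dots> = b2 ^ n * (5 + 4 * q2)" by (simp add: algebra_simps)
  also have "\<dots> \<le> b2 ^ n * (3 * b2)" using q2 by (intro mult_left_mono) (auto simp: b2_def)
  finally show ?case by (simp add: mult_ac)
qed (simp add: ys_def)

text \<open>The coordinates are final from level \<open>Suc j\<close> on: the digits of
  \<open>j\<close> are exhausted by level \<open>j\<close>, and the sum up to \<open>Suc j\<close>
  includes the shift made at level \<open>j\<close>.\<close>

definition lx :: "nat \<Rightarrow> int" where "lx j = xs (Suc j) j"
definition ly :: "nat \<Rightarrow> int" where "ly j = ys (Suc j) j"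
definition lam :: "nat \<Rightarrow> real \<times> real" where "lam j = (real_of_int (lx j), real_of_int (ly j))"

lemma lx_eq:
  assumes "j < 3 ^ n" shows "lx j = xs n j"
proof -
  have "j < 3 ^ Suc j" using less_power3[of "Suc j"] by linarith
  hence "xs (max n (Suc j)) j = lx j" unfolding lx_def by (intro xs_stable) auto
  moreover have "xs (max n (Suc j)) j = xs n j" using assms by (intro xs_stable) auto
  ultimately show ?thesis by simp
qed

text \<open>The extra summand is the shift still pending at level \<open>n\<close>. It is the reason
  why later estimates at level \<open>n\<close> distinguish two cases.\<close>

lemma ly_eq:
  assumes "j < 3 ^ n"
  shows "ly j = ys n j + (if n \<le> j \<and> j \<notin> W then b2 ^ j else 0)"
proof -
  have "j < 3 ^ Suc j" using less_power3[of "Suc j"] by linarith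
  hence "ys (max n (Suc j)) j = ly j" unfolding ly_def by (subst ys_stable[of _ "Suc j"]) auto
  moreover have "ys (max n (Suc j)) j = ys n j + (if n \<le> j \<and> j \<notin> W then b2 ^ j else 0)"
    using assms by (subst ys_stable[of _ n]) auto
  ultimately show ?thesis by simp
qed

end

section \<open>Parseval identity for the finite products\<close>

definition sier_mask :: "real \<Rightarrow> real \<Rightarrow> complex" where
  "sier_mask s t = (1 + cis (- (2 * pi * s)) + cis (- (2 * pi * t))) / 3"

lemma cis_2pi_add_int: "cis (- (2 * pi * (s + of_int a))) = cis (- (2 * pi * s))"
proof -
  have "cis (- (2 * pi * (s + of_int a))) = cis (- (2 * pi * s)) * cis (2 * pi * of_int (- a))"
    by (simp add: cis_mult algebra_simps)
  also have "cis (2 * pi * of_int (- a)) = 1" by (rule cis_multiple_2pi) auto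
  finally show ?thesis by simp
qed

lemma sier_mask_periodic: "sier_mask (s + of_int a) (t + of_int b) = sier_mask s t"
  unfolding sier_mask_def cis_2pi_add_int ..

lemma sier_mask_0 [simp]: "sier_mask 0 0 = 1" by (simp add: sier_mask_def)

lemma norm_sier_mask_le: "cmod (sier_mask s t) \<le> 1"
proof -
  have "cmod (1 + cis (- (2 * pi * s)) + cis (- (2 * pi * t))) \<le> 1 + 1 + 1"
    by (intro norm_triangle_mono) auto
  thus ?thesis by (simp add: sier_mask_def norm_divide)
qed

text \<open>Three complex numbers of modulus 1 add up to zero only if they form an equilateral
  triangle, which here forces \<open>cos (2 * pi * s) = - 1 / 2\<close>. The restriction concerns
  \<open>s\<close> alone; \<open>t\<close> is arbitrary.\<close>

lemma sier_mask_nonzero: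
  assumes "\<bar>s\<bar> < 1 / 3" shows "sier_mask s t \<noteq> 0"
proof
  assume "sier_mask s t = 0"
  hence "1 + cis (- (2 * pi * s)) = - cis (- (2 * pi * t))" by (simp add: sier_mask_def add_eq_0_iff)
  hence "cmod (1 + cis (- (2 * pi * s))) = 1" by simp
  hence "(cmod (1 + cis (- (2 * pi * s))))\<^sup>2 = 1" by simp
  hence "(1 + cos (2 * pi * s))\<^sup>2 + (sin (2 * pi * s))\<^sup>2 = 1" by (simp add: cmod_power2)
  hence "cos (2 * pi * s) = - 1 / 2"
    using sin_cos_squared_add[of "2 * pi * s"] by (simp add: power2_eq_square algebra_simps)
  moreover have "cos (2 * pi / 3) < cos (2 * pi * \<bar>s\<bar>)"
    using assms pi_gt_zero by (intro cos_monotone_0_pi) (auto simp: field_simps)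
  moreover have "cos (2 * pi * \<bar>s\<bar>) = cos (2 * pi * s)" by (cases "s \<ge> 0") auto
  ultimately show False by (simp add: cos_120)
qed

text \<open>With \<open>a\<close>, \<open>b\<close> the two exponentials and \<open>w\<close> a
  primitive cube root of unity, the three masks are, up to normalisation, the discrete Fourier
  transform of order 3 of \<open>(1, a, b)\<close>. The identity is Parseval's for this
  transform.\<close>

lemma sum_norm_sier_mask_squared:
  "(cmod (sier_mask s t))\<^sup>2 + (cmod (sier_mask (s - 1 / 3) (t + 1 / 3)))\<^sup>2
    + (cmod (sier_mask (s + 1 / 3) (t + 2 / 3)))\<^sup>2 = 1"
proof -
  define a where "a = cis (- (2 * pi * s))"
  define b where "b = cis (- (2 * pi * t))"
  define w where "w = cis (2 * pi / 3)"
  have w: "Re w = - 1 / 2" "Im w = sqrt 3 / 2" by (simp_all add: w_def cos_120 sin_120)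
  have ab: "(Re a)\<^sup>2 + (Im a)\<^sup>2 = 1" "(Re b)\<^sup>2 + (Im b)\<^sup>2 = 1"
    by (simp_all add: a_def b_def)
  have 1: "cis (- (2 * pi * (s - 1 / 3))) = a * w" "cis (- (2 * pi * (t + 1 / 3))) = b * cnj w"
    "cis (- (2 * pi * (s + 1 / 3))) = a * cnj w"
    unfolding a_def b_def w_def cis_cnj cis_mult by (auto intro!: arg_cong[of _ _ cis] simp: field_simps)
  \<comment> \<open>By periodicity a translation by 2/3 is one by -1/3.\<close>
  have "cis (- (2 * pi * (t + 2 / 3))) = cis (- (2 * pi * ((t - 1 / 3) + of_int 1)))"
    by (simp add: algebra_simps)
  also have "\<dots> = cis (- (2 * pi * (t - 1 / 3)))" by (rule cis_2pi_add_int)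
  also have "\<dots> = b * w"
    unfolding b_def w_def cis_mult by (auto intro!: arg_cong[of _ _ cis] simp: field_simps)
  finally have 2: "cis (- (2 * pi * (t + 2 / 3))) = b * w" .
  have "(cmod (1 + a + b))\<^sup>2 + (cmod (1 + a * w + b * cnj w))\<^sup>2 + (cmod (1 + a * cnj w + b * w))\<^sup>2
     = 3 * (1 + ((Re a)\<^sup>2 + (Im a)\<^sup>2) + ((Re b)\<^sup>2 + (Im b)\<^sup>2))"
    unfolding cmod_power2 by (simp add: w power2_eq_square field_simps)
  hence "(cmod (1 + a + b))\<^sup>2 + (cmod (1 + a * w + b * cnj w))\<^sup>2 + (cmod (1 + a * cnj w + b * w))\<^sup>2 = 9"
    by (simp add: ab)
  thus ?thesis
    unfolding sier_mask_def 1 2 a_def[symmetric] b_def[symmetric] by (simp add: norm_divide power_divide field_simps)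
qed

context sierpinski_lattice
begin

definition masks :: "nat \<Rightarrow> real \<Rightarrow> real \<Rightarrow> complex" where
  "masks n s t = (\<Prod>k<n. sier_mask (s / real_of_int b1 ^ Suc k) (t / real_of_int b2 ^ Suc k))"

lemma masks_Suc: "masks (Suc n) s t = masks n s t * sier_mask (s / real_of_int b1 ^ Suc n) (t / real_of_int b2 ^ Suc n)"
  by (simp add: masks_def)

lemma masks_0 [simp]: "masks n 0 0 = 1" by (simp add: masks_def)

text \<open>For \<open>k < n\<close> the power \<open>b1 ^ Suc k\<close> divides
  \<open>b1 ^ n\<close>, likewise for \<open>b2\<close>, so each mask is moved by integers.\<close>

lemma masks_periodic:
  fixes s t :: real
  shows "masks n (s + of_int (b1 ^ n * a)) (t + of_int (b2 ^ n * b)) = masks n s t"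
  unfolding masks_def
proof (intro prod.cong refl)
  fix k assume "k \<in> {..<n}"
  then obtain m where n: "n = Suc k + m" by (metis lessThan_iff less_imp_Suc_add add_Suc)
  have "(s + of_int (b1 ^ n * a)) / real_of_int b1 ^ Suc k = s / real_of_int b1 ^ Suc k + of_int (b1 ^ m * a)"
       "(t + of_int (b2 ^ n * b)) / real_of_int b2 ^ Suc k = t / real_of_int b2 ^ Suc k + of_int (b2 ^ m * b)"
    using b1_ge b2_ge unfolding n by (simp_all add: power_add field_simps)
  thus "sier_mask ((s + of_int (b1 ^ n * a)) / of_int b1 ^ Suc k) ((t + of_int (b2 ^ n * b)) / of_int b2 ^ Suc k)
      = sier_mask (s / of_int b1 ^ Suc k) (t / of_int b2 ^ Suc k)"
    by (simp only: sier_mask_periodic)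
qed

text \<open>Induction over the levels. The first \<open>n\<close> masks do not distinguish the
  children of a node by periodicity, and the last mask is evaluated at the three translates of
  \<open>sum_norm_sier_mask_squared\<close>. The shift \<open>jump n i\<close> is common to the
  siblings, so it only changes the base point \<open>v\<close>.\<close>

lemma sum_norm_masks_squared:
  fixes s t :: real
  shows "(\<Sum>j<3 ^ n. (cmod (masks n (s + xs n j) (t + ys n j)))\<^sup>2) = 1"
proof (induction n)
  case 0
  show ?case by (simp add: masks_def xs_def ys_def)
next
  case (Suc n)
  have "(\<Sum>d<3. (cmod (masks (Suc n) (s + xs (Suc n) (i + d * 3 ^ n)) (t + ys (Suc n) (i + d * 3 ^ n))))\<^sup>2)
      = (cmod (masks n (s + xs n i) (t + ys n i)))\<^sup>2" if i: "i < 3 ^ n" for i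
  proof -
    define u where "u = (s + xs n i) / real_of_int b1 ^ Suc n"
    define v where "v = (t + ys n i + b2 ^ n * jump n i) / real_of_int b2 ^ Suc n"
    have step: "(cmod (masks (Suc n) (s + xs (Suc n) (i + d * 3 ^ n)) (t + ys (Suc n) (i + d * 3 ^ n))))\<^sup>2
      = (cmod (masks n (s + xs n i) (t + ys n i)))\<^sup>2 * (cmod (sier_mask (u + sgn3 d / 3) (v + d / 3)))\<^sup>2"
      if d: "d < 3" for d
    proof -
      have x: "s + xs (Suc n) (i + d * 3 ^ n) = (s + xs n i) + of_int (b1 ^ n * (q1 * sgn3 d))"
        by (simp add: xs_Suc_child[OF i d])
      have y: "t + ys (Suc n) (i + d * 3 ^ n) = (t + ys n i) + of_int (b2 ^ n * (q2 * int d + jump n i))"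
        by (simp add: ys_Suc_child[OF i d])
      have "((s + xs n i) + of_int (b1 ^ n * (q1 * sgn3 d))) / real_of_int b1 ^ Suc n = u + sgn3 d / 3"
        using q1 unfolding u_def b1_def by (simp add: field_simps)
      moreover have "((t + ys n i) + of_int (b2 ^ n * (q2 * int d + jump n i))) / real_of_int b2 ^ Suc n = v + d / 3"
        using q2 unfolding v_def b2_def by (simp add: field_simps)
      ultimately show ?thesis
        unfolding masks_Suc x y masks_periodic norm_mult power_mult_distrib by (simp only:)
    qed
    have "(\<Sum>d<3. (cmod (masks (Suc n) (s + xs (Suc n) (i + d * 3 ^ n)) (t + ys (Suc n) (i + d * 3 ^ n))))\<^sup>2)
       = (\<Sum>d<3. (cmod (masks n (s + xs n i) (t + ys n i)))\<^sup>2 * (cmod (sier_mask (u + sgn3 d / 3) (v + d / 3)))\<^sup>2)"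
      by (intro sum.cong refl step) simp
    also have "\<dots> = (cmod (masks n (s + xs n i) (t + ys n i)))\<^sup>2
        * ((cmod (sier_mask u v))\<^sup>2 + (cmod (sier_mask (u - 1 / 3) (v + 1 / 3)))\<^sup>2
           + (cmod (sier_mask (u + 1 / 3) (v + 2 / 3)))\<^sup>2)"
      by (simp add: numeral_3_eq_3 sgn3_def algebra_simps)
    finally show ?thesis by (simp add: sum_norm_sier_mask_squared)
  qed
  thus ?case unfolding sum_lessThan_power3_Suc using Suc by simp
qed

text \<open>A shift pending at level \<open>n\<close> is \<open>b2 ^ j\<close> with
  \<open>n \<le> j\<close>, a period of the first \<open>n\<close> masks.\<close>

lemma masks_lam:
  fixes s t :: real
  assumes "j < 3 ^ n"
  shows "masks n (s + lx j) (t + ly j) = masks n (s + xs n j) (t + ys n j)"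
proof -
  have "\<exists>b. ly j = ys n j + b2 ^ n * b"
  proof (cases "n \<le> j \<and> j \<notin> W")
    case True
    thus ?thesis unfolding ly_eq[OF assms]
      by (intro exI[of _ "b2 ^ (j - n)"]) (simp flip: power_add)
  next
    case False
    thus ?thesis unfolding ly_eq[OF assms] by (intro exI[of _ 0]) auto
  qed
  then obtain b where "ly j = ys n j + b2 ^ n * b" by blast
  thus ?thesis
    using masks_periodic[of n "s + xs n j" 0 "t + ys n j" b] lx_eq[OF assms] by (simp add: add.assoc)
qed

lemma sum_norm_masks_lam_squared:
  fixes s t :: real
  shows "(\<Sum>j<3 ^ n. (cmod (masks n (s + lx j) (t + ly j)))\<^sup>2) = 1"
  using sum_norm_masks_squared[of n s t] by (simp add: masks_lam)

text \<open>Orthogonality comes for free: at \<open>(s, t) = - lam i\<close> the summand \<open>i\<close> of Parseval's identity is already 1.\<close>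

lemma masks_diff_eq_0:
  assumes "i < 3 ^ n" "j < 3 ^ n" "i \<noteq> j"
  shows "masks n (real_of_int (lx j) - lx i) (real_of_int (ly j) - ly i) = 0"
proof -
  let ?f = "\<lambda>j. (cmod (masks n (- real_of_int (lx i) + lx j) (- real_of_int (ly i) + ly j)))\<^sup>2"
  have "1 + ?f j = (\<Sum>k\<in>{i, j}. ?f k)" using assms by simp
  also have "\<dots> \<le> (\<Sum>k<3 ^ n. ?f k)" using assms by (intro sum_mono2) auto
  also have "\<dots> = 1" by (rule sum_norm_masks_lam_squared)
  finally have "?f j = 0" by simp
  thus ?thesis by (simp add: add.commute)
qed

end

section \<open>The Fourier transform of the Sierpinski measure\<close>

locale sierpinski_measure = sierpinski_lattice +
  fixes M :: "(real \<times> real) measure"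
  assumes self_affine: "self_affine_measure (sier_A q1 q2) sier_D M"
begin

sublocale prob_space M
  using self_affine by (simp add: self_affine_measure_def)

lemma sets_M [measurable_cong]: "sets M = sets borel"
  using self_affine by (simp add: self_affine_measure_def)

lemma space_M: "space M = UNIV"
  using sets_eq_imp_space_eq[OF sets_M] by simp

text \<open>The maps inverse to \<open>sier_A q1 q2 x - d\<close>; the indices 0, 1, 2 stand for the
  digits \<open>(0, 0)\<close>, \<open>(1, 0)\<close>, \<open>(0, 1)\<close>.\<close>

definition branch :: "nat \<Rightarrow> real \<times> real \<Rightarrow> real \<times> real" where
  "branch i x = ((fst x + (if i = 1 then 1 else 0)) / b1, (snd x + (if i = 2 then 1 else 0)) / b2)"

lemma branch_measurable [measurable]: "branch i \<in> measurable M borel"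
  unfolding measurable_cong_sets[OF sets_M refl] branch_def
  by (intro borel_measurable_continuous_onI continuous_intros) (use b1_ge b2_ge in auto)

lemma measure_eq_sum_branch:
  assumes "E \<in> sets borel"
  shows "measure M E = (\<Sum>i<3. measure M (branch i -` E)) / 3"
proof -
  have vimage: "(\<lambda>x. sier_A q1 q2 x - d) ` E = (\<lambda>x. ((fst x + fst d) / b1, (snd x + snd d) / b2)) -` E" for d
  proof (intro equalityI subsetI)
    fix x assume "x \<in> (\<lambda>x. sier_A q1 q2 x - d) ` E"
    thus "x \<in> (\<lambda>x. ((fst x + fst d) / b1, (snd x + snd d) / b2)) -` E"
      using q1 q2 by (auto simp: sier_A_def b1_def b2_def)
  next
    fix x assume "x \<in> (\<lambda>x. ((fst x + fst d) / b1, (snd x + snd d) / b2)) -` E"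
    moreover have "x = sier_A q1 q2 ((fst x + fst d) / b1, (snd x + snd d) / b2) - d"
      using q1 q2 by (auto simp: sier_A_def b1_def b2_def prod_eq_iff)
    ultimately show "x \<in> (\<lambda>x. sier_A q1 q2 x - d) ` E" by blast
  qed
  have "measure M E = (1 / 3) * (\<Sum>d\<in>sier_D. measure M ((\<lambda>x. sier_A q1 q2 x - d) ` E))"
    using self_affine assms unfolding self_affine_measure_def by (simp add: sier_D_def)
  also have "\<dots> = (\<Sum>i<3. measure M (branch i -` E)) / 3"
    unfolding vimage by (simp add: sier_D_def branch_def[abs_def] numeral_3_eq_3 add.assoc)
  finally show ?thesis .
qed

text \<open>Self-affinity says that \<open>M\<close> is the law \<open>N\<close> of
  \<open>branch i x\<close> for a uniform index \<open>i\<close> and an independent point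
  \<open>x\<close> with law \<open>M\<close>. Once the two measures are identified on Borel sets,
  the formula is integration with respect to \<open>N\<close> by Fubini.\<close>

lemma integral_eq_sum_branch:
  fixes g :: "real \<times> real \<Rightarrow> complex"
  assumes g [measurable]: "g \<in> borel_measurable borel" and bounded: "\<And>x. cmod (g x) \<le> 1"
  shows "(LINT x|M. g x) = (\<Sum>i<3. LINT x|M. g (branch i x)) / 3"
proof -
  define P where "P = measure_pmf (pmf_of_set {..<3::nat})"
  interpret P: prob_space P unfolding P_def by (rule prob_space_measure_pmf)
  interpret PM: pair_prob_space P M ..
  have branch2 [measurable]: "case_prod branch \<in> measurable (P \<Otimes>\<^sub>M M) borel"
  proof -
    have "case_prod branch \<in> measurable (count_space UNIV \<Otimes>\<^sub>M M) borel"
      by (rule measurable_pair_measure_countable1) auto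
    moreover have "sets (P \<Otimes>\<^sub>M M) = sets (count_space UNIV \<Otimes>\<^sub>M M)"
      unfolding P_def by (intro sets_pair_measure_cong) auto
    ultimately show ?thesis using measurable_cong_sets[of "P \<Otimes>\<^sub>M M" _ borel borel] by blast
  qed
  define N where "N = distr (P \<Otimes>\<^sub>M M) borel (case_prod branch)"
  interpret N: prob_space N unfolding N_def by (rule PM.prob_space_distr) measurable
  have N_integral: "(LINT x|N. h x) = (\<Sum>i<3. LINT x|M. h (branch i x)) / 3"
    if [measurable]: "h \<in> borel_measurable borel" and "\<And>x. cmod (h x) \<le> 1" for h :: "real \<times> real \<Rightarrow> complex"
  proof -
    have "(LINT x|N. h x) = (LINT z|(P \<Otimes>\<^sub>M M). h (case_prod branch z))"
      unfolding N_def by (rule integral_distr) measurable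
    also have "\<dots> = (LINT i|P. (LINT x|M. h (branch i x)))"
      by (subst PM.integral_fst'[symmetric]) (auto intro!: PM.integrable_const_bound[of _ 1] that(2))
    also have "\<dots> = (\<Sum>i<3. LINT x|M. h (branch i x)) / 3"
    proof -
      have ne: "{..<3::nat} \<noteq> {}" by (simp add: lessThan_empty_iff)
      show ?thesis
        unfolding P_def by (subst integral_measure_pmf[of "{..<3}"])
          (simp_all add: set_pmf_of_set[OF ne] pmf_of_set[OF ne] sum_divide_distrib scaleR_conv_of_real)
    qed
    finally show ?thesis .
  qed
  have indicator_integral: "(LINT x|L. indicator F x) = complex_of_real (measure L F)"
    if "F \<in> sets L" for F and L :: "(real \<times> real) measure"
  proof -
    have "(LINT x|L. indicator F x) = (LINT x|L. complex_of_real (indicator F x))"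
      by (simp add: of_real_indicator)
    also have "\<dots> = complex_of_real (measure L F)"
      unfolding integral_complex_of_real using sets.sets_into_space[OF that] by (simp add: Int_absorb2)
    finally show ?thesis .
  qed
  have "M = N"
  proof (rule measure_eqI)
    show "sets M = sets N" by (simp add: N_def sets_M)
    fix E assume "E \<in> sets M"
    hence [measurable]: "E \<in> sets borel" by (simp add: sets_M)
    have "branch i -` E \<inter> space M \<in> sets M" for i by measurable
    hence br: "branch i -` E \<in> sets M" for i by (simp add: space_M)
    have "complex_of_real (measure N E) = (LINT x|N. indicator E x)"
      by (subst indicator_integral) (auto simp: N_def)
    also have "\<dots> = (\<Sum>i<3. LINT x|M. indicator E (branch i x)) / 3"
      by (rule N_integral) (auto simp: indicator_def)
    also have "\<dots> = (\<Sum>i<3. LINT x|M. indicator (branch i -` E) x) / 3"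
      by (simp only: indicator_def vimage_eq)
    also have "\<dots>
        = complex_of_real ((\<Sum>i<3. measure M (branch i -` E)) / 3)"
      using br by (simp add: indicator_integral)
    also have "\<dots> = complex_of_real (measure M E)" by (subst measure_eq_sum_branch[of E]) simp_all
    finally have "measure N E = measure M E" by (simp only: of_real_eq_iff)
    thus "emeasure M E = emeasure N E"
      by (simp add: emeasure_eq_measure N.emeasure_eq_measure)
  qed
  thus ?thesis using N_integral[OF g bounded] by simp
qed

definition muhat :: "real \<Rightarrow> real \<Rightarrow> complex" where
  "muhat s t = (LINT x|M. expo (s, t) x)"

lemma expo_measurable_M [measurable]: "expo l \<in> borel_measurable M"
  unfolding measurable_cong_sets[OF sets_M refl] by (rule expo_measurable)

lemma muhat_0 [simp]: "muhat 0 0 = 1"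
  by (simp add: muhat_def prob_space flip: zero_prod_def)

lemma expo_branch:
  "expo (s, t) (branch i x) = expo (s / b1, t / b2) x * cis (- (2 * pi * (if i = 1 then s / b1 else 0)))
     * cis (- (2 * pi * (if i = 2 then t / b2 else 0)))"
  unfolding expo_def branch_def cis_conv_exp exp_add[symmetric]
  by (rule arg_cong[of _ _ exp]) (use b1_ge b2_ge in \<open>auto simp: inner_prod_def field_simps\<close>)

lemma muhat_step: "muhat s t = sier_mask (s / b1) (t / b2) * muhat (s / b1) (t / b2)"
proof -
  have "muhat s t = (\<Sum>i<3. LINT x|M. expo (s, t) (branch i x)) / 3"
    unfolding muhat_def by (rule integral_eq_sum_branch) auto
  also have "\<dots> = (muhat (s / b1) (t / b2) + muhat (s / b1) (t / b2) * cis (- (2 * pi * (s / b1)))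
      + muhat (s / b1) (t / b2) * cis (- (2 * pi * (t / b2)))) / 3"
    unfolding expo_branch muhat_def by (simp add: numeral_3_eq_3)
  finally show ?thesis by (simp add: sier_mask_def field_simps)
qed

lemma muhat_masks: "muhat s t = masks n s t * muhat (s / b1 ^ n) (t / b2 ^ n)"
proof (induction n)
  case 0
  show ?case by (simp add: masks_def)
next
  case (Suc n)
  thus ?case using muhat_step[of "s / b1 ^ n" "t / b2 ^ n"]
    by (simp add: masks_Suc mult_ac)
qed

lemma norm_muhat_le: "cmod (muhat s t) \<le> 1"
proof -
  have "cmod (muhat s t) \<le> (LINT x|M. cmod (expo (s, t) x))"
    unfolding muhat_def by (rule integral_norm_bound)
  thus ?thesis by (simp add: prob_space)
qed

lemma muhat_tendsto:
  assumes "s \<longlonglongrightarrow> a" "t \<longlonglongrightarrow> b"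
  shows "(\<lambda>n. muhat (s n) (t n)) \<longlonglongrightarrow> muhat a b"
  unfolding muhat_def
proof (rule integral_dominated_convergence[where w = "\<lambda>_. 1"])
  show "AE x in M. (\<lambda>n. expo (s n, t n) x) \<longlonglongrightarrow> expo (a, b) x"
    unfolding expo_def using assms by (auto simp: inner_prod_def intro!: tendsto_intros)
qed auto

lemma tendsto_divide_b: "(\<lambda>n. c / real_of_int b1 ^ n) \<longlonglongrightarrow> 0" "(\<lambda>n. c / real_of_int b2 ^ n) \<longlonglongrightarrow> 0"
proof -
  have "(\<lambda>n. c * inverse (real_of_int b) ^ n) \<longlonglongrightarrow> c * 0" if "b \<ge> 3" for b
    using that by (intro tendsto_mult tendsto_const LIMSEQ_realpow_zero) (auto simp: inverse_less_1_iff)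
  from this[OF b1_ge] this[OF b2_ge]
  show "(\<lambda>n. c / real_of_int b1 ^ n) \<longlonglongrightarrow> 0" "(\<lambda>n. c / real_of_int b2 ^ n) \<longlonglongrightarrow> 0"
    by (simp_all add: divide_inverse power_inverse)
qed

text \<open>The remaining factor in \<open>muhat_masks\<close> tends to
  \<open>muhat 0 0 = 1\<close>, so one may divide by it for large \<open>n\<close>.\<close>

lemma masks_tendsto: "(\<lambda>n. masks n s t) \<longlonglongrightarrow> muhat s t"
proof -
  have lim: "(\<lambda>n. muhat (s / b1 ^ n) (t / b2 ^ n)) \<longlonglongrightarrow> 1"
    using muhat_tendsto[OF tendsto_divide_b(1)[of s] tendsto_divide_b(2)[of t]] by simp
  hence "(\<lambda>n. muhat s t / muhat (s / b1 ^ n) (t / b2 ^ n)) \<longlonglongrightarrow> muhat s t / 1"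
    by (intro tendsto_intros) auto
  moreover have "\<forall>\<^sub>F n in sequentially. muhat (s / b1 ^ n) (t / b2 ^ n) \<noteq> 0"
    using lim by (rule tendsto_imp_eventually_ne) simp
  hence "\<forall>\<^sub>F n in sequentially. muhat s t / muhat (s / b1 ^ n) (t / b2 ^ n) = masks n s t"
    by eventually_elim (use muhat_masks[of s t] in \<open>simp add: field_simps\<close>)
  ultimately show ?thesis by (simp add: tendsto_cong)
qed

text \<open>In \<open>muhat_masks\<close> the last factor is nonzero for large \<open>n\<close> by
  continuity at 0, and since \<open>b1\<close> is at least 3 each mask has first argument below 1/3
  in modulus. As \<open>t\<close> is unrestricted, shifts of the second coordinate cannot produce
  zeros.\<close>

lemma muhat_nonzero:
  assumes "\<bar>s\<bar> < 1" shows "muhat s t \<noteq> 0"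
proof -
  have "(\<lambda>n. muhat (s / b1 ^ n) (t / b2 ^ n)) \<longlonglongrightarrow> 1"
    using muhat_tendsto[OF tendsto_divide_b(1)[of s] tendsto_divide_b(2)[of t]] by simp
  hence "\<forall>\<^sub>F n in sequentially. muhat (s / b1 ^ n) (t / b2 ^ n) \<noteq> 0"
    by (rule tendsto_imp_eventually_ne) simp
  then obtain n where "muhat (s / b1 ^ n) (t / b2 ^ n) \<noteq> 0" by (auto simp: eventually_sequentially)
  moreover have "sier_mask (s / real_of_int b1 ^ Suc k) (t / real_of_int b2 ^ Suc k) \<noteq> 0" for k
  proof (rule sier_mask_nonzero)
    have "(3::real) * 1 \<le> real_of_int b1 * real_of_int b1 ^ k"
      using b1_ge by (intro mult_mono one_le_power) auto
    thus "\<bar>s / real_of_int b1 ^ Suc k\<bar> < 1 / 3" using assms b1_ge by (simp add: abs_mult field_simps)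
  qed
  ultimately show ?thesis unfolding muhat_masks[of s t n] by (simp add: masks_def)
qed

text \<open>A continuous function without zeros on a compact rectangle. Its size is chosen for the
  next lemma: 1/2 + 1/6 = 2/3 in the first coordinate, and in the second 3/2 + 1/6 = 5/3, to which a
  pending shift may add 1.\<close>

lemma muhat_lower_bound:
  "\<exists>\<delta>>0. \<forall>s t. \<bar>s\<bar> \<le> 2 / 3 \<longrightarrow> \<bar>t\<bar> \<le> 3 \<longrightarrow> \<delta> \<le> cmod (muhat s t)"
proof -
  define K where "K = {-2/3..2/3::real} \<times> {-3..3::real}"
  have cont: "continuous_on K (\<lambda>z. cmod (muhat (fst z) (snd z)))"
    unfolding continuous_on_sequentially o_def
    by (intro allI ballI impI tendsto_norm muhat_tendsto) (auto intro!: tendsto_fst tendsto_snd)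
  have K: "compact K" "K \<noteq> {}" unfolding K_def by (auto intro!: compact_Times)
  obtain z where z: "z \<in> K" "\<And>y. y \<in> K \<Longrightarrow> cmod (muhat (fst z) (snd z)) \<le> cmod (muhat (fst y) (snd y))"
    using continuous_attains_inf[OF K cont] by meson
  show ?thesis
  proof (intro exI conjI allI impI)
    show "0 < cmod (muhat (fst z) (snd z))" using z(1) muhat_nonzero by (auto simp: K_def)
    fix s t :: real assume "\<bar>s\<bar> \<le> 2 / 3" "\<bar>t\<bar> \<le> 3"
    hence "(s, t) \<in> K" unfolding K_def by (auto simp: abs_le_iff)
    thus "cmod (muhat (fst z) (snd z)) \<le> cmod (muhat s t)" using z(2)[of "(s, t)"] by simp
  qed
qed

text \<open>Without a pending shift the rescaled frequency lies in the rectangle of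
  \<open>muhat_lower_bound\<close>. With one, it is a point \<open>(u, v)\<close> of the rectangle
  moved by \<open>b2 ^ m\<close> in the second coordinate. The first \<open>m\<close> masks do not
  see this move, and after \<open>m\<close> further rescalings it has become a move by 1, so each of
  the two factors is at least \<delta>. The bound is uniform in \<open>s\<close> and
  \<open>t\<close>; only \<open>n0\<close> depends on them.\<close>

lemma muhat_lam_lower_bound:
  "\<exists>\<delta>>0. \<forall>(s::real) (t::real). \<exists>n0. \<forall>n\<ge>n0. \<forall>j<3 ^ n.
     \<delta> \<le> cmod (muhat ((s + lx j) / b1 ^ n) ((t + ly j) / b2 ^ n))"
proof -
  obtain \<delta> where \<delta>: "\<delta> > 0" and low: "\<And>s t. \<bar>s\<bar> \<le> 2 / 3 \<Longrightarrow> \<bar>t\<bar> \<le> 3 \<Longrightarrow> \<delta> \<le> cmod (muhat s t)"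
    using muhat_lower_bound by blast
  have \<delta>1: "\<delta> \<le> 1" using low[of 0 0] by simp
  have "\<exists>n0. \<forall>n\<ge>n0. \<forall>j<3 ^ n. \<delta> * \<delta> \<le> cmod (muhat ((s + lx j) / b1 ^ n) ((t + ly j) / b2 ^ n))" for s t :: real
  proof -
    \<comment> \<open>1/6 is the room between the bound 1/2 for the rescaled \<open>xs n j\<close>
      and the 2/3 of the rectangle.\<close>
    have "\<forall>\<^sub>F n in sequentially. norm (s / real_of_int b1 ^ n) < 1 / 6"
      by (rule order_tendstoD(2)[OF tendsto_norm_zero[OF tendsto_divide_b(1)[of s]]]) simp
    moreover have "\<forall>\<^sub>F n in sequentially. norm (t / real_of_int b2 ^ n) < 1 / 6"
      by (rule order_tendstoD(2)[OF tendsto_norm_zero[OF tendsto_divide_b(2)[of t]]]) simp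
    ultimately have "\<forall>\<^sub>F n in sequentially. \<bar>s / real_of_int b1 ^ n\<bar> < 1 / 6 \<and> \<bar>t / real_of_int b2 ^ n\<bar> < 1 / 6"
      by eventually_elim (simp only: real_norm_def)
    then obtain n0 where n0: "\<And>n. n \<ge> n0 \<Longrightarrow> \<bar>s / real_of_int b1 ^ n\<bar> < 1 / 6 \<and> \<bar>t / real_of_int b2 ^ n\<bar> < 1 / 6"
      unfolding eventually_sequentially by meson
    have "\<delta> * \<delta> \<le> cmod (muhat ((s + lx j) / b1 ^ n) ((t + ly j) / b2 ^ n))"
      if n: "n \<ge> n0" and j: "j < 3 ^ n" for n j
    proof -
      define u where "u = (s + xs n j) / real_of_int b1 ^ n"
      define v where "v = (t + ys n j) / real_of_int b2 ^ n"
      have pos: "real_of_int b1 ^ n > 0" "real_of_int b2 ^ n > 0" using b1_ge b2_ge by auto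
      have "\<bar>real_of_int (xs n j)\<bar> * 2 \<le> real_of_int (b1 ^ n)"
        using xs_bound[of n j] by linarith
      hence "\<bar>xs n j / real_of_int b1 ^ n\<bar> \<le> 1 / 2" using pos by (simp add: abs_divide field_simps)
      moreover have "u = s / real_of_int b1 ^ n + xs n j / real_of_int b1 ^ n"
        by (simp add: u_def add_divide_distrib)
      ultimately have u: "\<bar>u\<bar> \<le> 2 / 3" using n0[OF n] by linarith
      have "real_of_int (ys n j) * 2 \<le> 3 * real_of_int (b2 ^ n)" "0 \<le> real_of_int (ys n j)"
        using ys_bound[of n j] ys_nonneg[of n j] by linarith+
      hence "0 \<le> ys n j / real_of_int b2 ^ n" "ys n j / real_of_int b2 ^ n \<le> 3 / 2"
        using pos by (auto simp: field_simps)
      moreover have "v = t / real_of_int b2 ^ n + ys n j / real_of_int b2 ^ n"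
        by (simp add: v_def add_divide_distrib)
      ultimately have v: "\<bar>v\<bar> \<le> 5 / 3" using n0[OF n] by linarith
      have x: "(s + lx j) / b1 ^ n = u" by (simp add: u_def lx_eq[OF j])
      show ?thesis
      proof (cases "n \<le> j \<and> j \<notin> W")
        case False
        hence "(t + ly j) / b2 ^ n = v" by (auto simp: v_def ly_eq[OF j])
        moreover have "\<delta> * \<delta> \<le> \<delta>" using \<delta> \<delta>1 by (simp add: mult_left_le)
        moreover have "\<delta> \<le> cmod (muhat u v)" using low u v by simp
        ultimately show ?thesis unfolding x by simp
      next
        case True
        define m where "m = j - n"
        have "real_of_int b2 ^ j = real_of_int b2 ^ m * real_of_int b2 ^ n"
          using True by (simp add: m_def flip: power_add)
        hence y: "(t + ly j) / b2 ^ n = v + of_int (b2 ^ m * 1)"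
          using True b2_ge by (simp add: v_def ly_eq[OF j] add_divide_distrib)
        have "muhat u (v + of_int (b2 ^ m * 1)) = masks m u v * muhat (u / real_of_int b1 ^ m) (v / real_of_int b2 ^ m + 1)"
          using muhat_masks[of u "v + of_int (b2 ^ m * 1)" m] masks_periodic[of m u 0 v 1] b2_ge
          by (simp add: field_simps)
        \<comment> \<open>The finite product dominates the infinite one, which is bounded below at
          \<open>(u, v)\<close>.\<close>
        moreover have "\<delta> \<le> cmod (masks m u v)"
        proof -
          have "\<delta> \<le> cmod (muhat u v)" using low u v by simp
          also have "\<dots> = cmod (masks m u v) * cmod (muhat (u / real_of_int b1 ^ m) (v / real_of_int b2 ^ m))"
            by (subst muhat_masks[of u v m]) (simp add: norm_mult)
          also have "\<dots> \<le> cmod (masks m u v) * 1" using norm_muhat_le by (intro mult_left_mono) auto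
          finally show ?thesis by simp
        qed
        moreover have "\<delta> \<le> cmod (muhat (u / real_of_int b1 ^ m) (v / real_of_int b2 ^ m + 1))"
        proof (rule low)
          have shrink: "\<bar>c / real_of_int b ^ m\<bar> \<le> \<bar>c\<bar>" if "b \<ge> 3" for c b
          proof -
            have "1 \<le> real_of_int b ^ m" using that by (intro one_le_power) auto
            thus ?thesis using mult_left_mono[of 1 "real_of_int b ^ m" "\<bar>c\<bar>"]
              by (simp add: abs_divide divide_le_eq)
          qed
          show "\<bar>u / real_of_int b1 ^ m\<bar> \<le> 2 / 3" using shrink[OF b1_ge, of u] u by linarith
          show "\<bar>v / real_of_int b2 ^ m + 1\<bar> \<le> 3" using shrink[OF b2_ge, of v] v by linarith
        qed
        ultimately show ?thesis unfolding x y norm_mult using \<delta>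
          by (simp add: norm_mult mult_mono)
      qed
    qed
    thus ?thesis by blast
  qed
  moreover have "\<delta> * \<delta> > 0" using \<delta> by simp
  ultimately show ?thesis by blast
qed

section \<open>Orthogonality and completeness of the frequencies\<close>

lemma muhat_minus: "cmod (muhat (- s) (- t)) = cmod (muhat s t)"
proof -
  have "muhat (- s) (- t) = (LINT x|M. cnj (expo (s, t) x))"
    unfolding muhat_def cnj_expo by simp
  also have "\<dots> = cnj (muhat s t)" unfolding muhat_def by (rule Bochner_Integration.integral_cnj)
  finally show ?thesis by simp
qed

text \<open>If two frequencies coincided, the vanishing product of \<open>masks_diff_eq_0\<close>
  would be \<open>masks n 0 0 = 1\<close>.\<close>

lemma inj_lam: "inj lam"
proof (rule injI, rule ccontr)
  fix i j assume eq: "lam i = lam j" and "i \<noteq> j"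
  define n where "n = max i j"
  have "(3::nat) ^ i \<le> 3 ^ n" "(3::nat) ^ j \<le> 3 ^ n" unfolding n_def by (intro power_increasing; simp)+
  hence "i < 3 ^ n" "j < 3 ^ n" using less_power3[of i] less_power3[of j] by linarith+
  from masks_diff_eq_0[OF this \<open>i \<noteq> j\<close>] eq show False by (simp add: lam_def)
qed

lemma lam_orthogonal:
  assumes "i \<noteq> j" shows "L2_inner M (expo (lam i)) (expo (lam j)) = 0"
proof -
  define n where "n = max i j"
  have "(3::nat) ^ i \<le> 3 ^ n" "(3::nat) ^ j \<le> 3 ^ n" unfolding n_def by (intro power_increasing; simp)+
  hence "j < 3 ^ n" "i < 3 ^ n" using less_power3[of i] less_power3[of j] by linarith+
  from masks_diff_eq_0[OF this] assms have "masks n (real_of_int (lx i) - lx j) (real_of_int (ly i) - ly j) = 0"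
    by simp
  hence "muhat (real_of_int (lx i) - lx j) (real_of_int (ly i) - ly j) = 0"
    using muhat_masks[of "real_of_int (lx i) - lx j" "real_of_int (ly i) - ly j" n] by simp
  thus ?thesis by (simp add: L2_inner_expo_expo muhat_def lam_def)
qed

text \<open>Dominated convergence for series, done by hand. The terms \<open>g n j\<close> of the
  finite Parseval identities tend to \<open>c j\<close> as \<open>n\<close> grows, and
  \<open>muhat_lam_lower_bound\<close> dominates them by \<open>c j / \<delta>\<^sup>2\<close>,
  which is summable since the partial sums of \<open>c\<close> are at most 1.\<close>

lemma parseval_approx:
  fixes s t e :: real
  assumes "e > 0"
  shows "\<exists>m. 1 - e \<le> (\<Sum>j<3 ^ m. (cmod (muhat (s + lx j) (t + ly j)))\<^sup>2)"
proof -
  obtain \<delta> n0 where \<delta>: "\<delta> > 0" and low: "\<And>n j. n \<ge> n0 \<Longrightarrow> j < 3 ^ n \<Longrightarrow>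
     \<delta> \<le> cmod (muhat ((s + lx j) / b1 ^ n) ((t + ly j) / b2 ^ n))"
    using muhat_lam_lower_bound by meson
  define c where "c j = (cmod (muhat (s + lx j) (t + ly j)))\<^sup>2" for j
  define g where "g n j = (cmod (masks n (s + lx j) (t + ly j)))\<^sup>2" for n j
  define S where "S n = (\<Sum>j<3 ^ n. c j)" for n
  have c_eq: "c j = g n j * (cmod (muhat ((s + lx j) / b1 ^ n) ((t + ly j) / b2 ^ n)))\<^sup>2" for j n
    unfolding c_def g_def by (subst muhat_masks[of _ _ n]) (simp add: norm_mult power_mult_distrib)
  have c_le: "c j \<le> g n j" for j n
  proof -
    have "(cmod (muhat ((s + lx j) / b1 ^ n) ((t + ly j) / b2 ^ n)))\<^sup>2 \<le> 1"
      by (intro power_le_one norm_muhat_le) simp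
    thus ?thesis unfolding c_eq[of j n] by (intro mult_left_le) (auto simp: g_def)
  qed
  have g_le: "g n j * \<delta>\<^sup>2 \<le> c j" if "n \<ge> n0" "j < 3 ^ n" for n j
    unfolding c_eq[of j n] using low[OF that] \<delta> by (intro mult_left_mono power_mono) (auto simp: g_def)
  have g_sum: "(\<Sum>j<3 ^ n. g n j) = 1" for n unfolding g_def by (rule sum_norm_masks_lam_squared)
  have "S n \<le> 1" for n unfolding S_def g_sum[of n, symmetric] by (intro sum_mono c_le)
  moreover have mono: "incseq S"
    unfolding S_def incseq_def by (intro allI impI sum_mono2) (auto simp: c_def intro: order_less_le_trans power_increasing)
  ultimately obtain L where L: "S \<longlonglongrightarrow> L" "\<And>n. S n \<le> L"
    using incseq_convergent[of S 1] by metis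
  have "e * \<delta>\<^sup>2 > 0" using assms \<delta> by simp
  hence "\<forall>\<^sub>F n in sequentially. S n > L - e * \<delta>\<^sup>2" using L(1) by (intro order_tendstoD) auto
  then obtain m0 where m0: "\<And>n. n \<ge> m0 \<Longrightarrow> S n > L - e * \<delta>\<^sup>2" by (auto simp: eventually_sequentially)
  define m where "m = max m0 n0"
  \<comment> \<open>The head of the finite identity keeps mass \<open>1 - e\<close> uniformly in
    \<open>n\<close>: the tail of \<open>g n\<close> is at most that of \<open>c\<close> divided by
    \<open>\<delta>\<^sup>2\<close>, and \<open>m0\<close> was chosen to make the latter at most
    \<open>e\<close>.\<close>
  have fin: "1 - e \<le> (\<Sum>j<3 ^ m. g n j)" if n: "n \<ge> m" for n
  proof -
    have sub: "{..<3 ^ m} \<subseteq> {..<3 ^ n::nat}" using n by (auto intro: order_less_le_trans power_increasing)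
    have "\<delta>\<^sup>2 * (\<Sum>j\<in>{..<3 ^ n} - {..<3 ^ m}. g n j) \<le> (\<Sum>j\<in>{..<3 ^ n} - {..<3 ^ m}. c j)"
      unfolding sum_distrib_left using n by (intro sum_mono) (auto simp: m_def mult.commute intro!: g_le)
    also have "\<dots> = S n - S m" unfolding S_def using sum.subset_diff[OF sub finite_lessThan, of c] by linarith
    also have "\<dots> \<le> \<delta>\<^sup>2 * e" using L(2)[of n] m0[of m] by (simp add: m_def mult.commute)
    finally have "(\<Sum>j\<in>{..<3 ^ n} - {..<3 ^ m}. g n j) \<le> e" using \<delta> by simp
    moreover have "(\<Sum>j\<in>{..<3 ^ n} - {..<3 ^ m}. g n j) = 1 - (\<Sum>j<3 ^ m. g n j)"
      using sum.subset_diff[OF sub finite_lessThan, of "g n"] g_sum[of n] by linarith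
    ultimately show ?thesis by simp
  qed
  \<comment> \<open>Now \<open>m\<close> is fixed, so the limit is taken in a finite sum.\<close>
  have "(\<lambda>n. \<Sum>j<3 ^ m. g n j) \<longlonglongrightarrow> (\<Sum>j<3 ^ m. c j)"
    unfolding g_def c_def by (intro tendsto_intros masks_tendsto)
  hence "1 - e \<le> (\<Sum>j<3 ^ m. c j)"
    by (rule tendsto_lowerbound) (auto intro!: eventually_sequentiallyI[of m] fin)
  thus ?thesis unfolding c_def by blast
qed

lemma spectrum_range_lam: "is_spectrum M (range lam)"
proof (rule is_spectrumI)
  show "prob_space M" by (rule prob_space_axioms)
  show "sets M = sets borel" by (rule sets_M)
  show "countable (range lam)" by simp
  show "L2_inner M (expo l) (expo l') = 0" if l: "l \<in> range lam" "l' \<in> range lam" "l \<noteq> l'" for l l'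
  proof -
    obtain i j where "l = lam i" "l' = lam j" using l(1,2) by blast
    thus ?thesis using l(3) lam_orthogonal[of i j] by metis
  qed
  fix \<xi> :: "real \<times> real" and e :: real assume "e > 0"
  then obtain m where m: "1 - e \<le> (\<Sum>j<3 ^ m. (cmod (muhat (- fst \<xi> + lx j) (- snd \<xi> + ly j)))\<^sup>2)"
    using parseval_approx by blast
  have "cmod (L2_inner M (expo \<xi>) (expo (lam j))) = cmod (muhat (- fst \<xi> + lx j) (- snd \<xi> + ly j))" for j
  proof -
    have "\<xi> - lam j = (- (- fst \<xi> + lx j), - (- snd \<xi> + ly j))"
      by (simp add: lam_def prod_eq_iff)
    hence "L2_inner M (expo \<xi>) (expo (lam j)) = muhat (- (- fst \<xi> + lx j)) (- (- snd \<xi> + ly j))"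
      by (simp only: L2_inner_expo_expo muhat_def)
    thus ?thesis by (simp only: muhat_minus)
  qed
  hence "(\<Sum>l\<in>lam ` {..<3 ^ m}. (cmod (L2_inner M (expo \<xi>) (expo l)))\<^sup>2)
     = (\<Sum>j<3 ^ m. (cmod (muhat (- fst \<xi> + lx j) (- snd \<xi> + ly j)))\<^sup>2)"
    by (subst sum.reindex) (auto intro: inj_on_subset[OF inj_lam])
  thus "\<exists>F\<subseteq>range lam. finite F \<and> 1 - e \<le> (\<Sum>l\<in>F. (cmod (L2_inner M (expo \<xi>) (expo l)))\<^sup>2)"
    using m by (intro exI[of _ "lam ` {..<3 ^ m}"]) auto
qed

end

section \<open>Beurling dimension\<close>

lemma upper_beurling_density_nonneg: "0 \<le> upper_beurling_density \<Lambda> r"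
proof -
  have "0 \<le> (SUP x. ecount (\<Lambda> \<inter> ball x h) / ereal (h powr r))" if "h > 0" for h
    using that by (intro SUP_upper2[of undefined]) (auto simp: ecount_def)
  hence "\<forall>\<^sub>F h in at_top. 0 \<le> (SUP x. ecount (\<Lambda> \<inter> ball x h) / ereal (h powr r))"
    by (rule eventually_mono[OF eventually_gt_at_top])
  thus ?thesis unfolding upper_beurling_density_def by (intro le_Limsup) auto
qed

text \<open>Counting bounds along the radii \<open>B ^ n\<close> suffice: a radius \<open>h\<close>
  is replaced by the next power above it, at the cost of a factor \<open>B powr r\<close>.\<close>

lemma upper_beurling_density_eq_0:
  fixes \<Lambda> :: "'a::metric_space set" and f :: "nat \<Rightarrow> real"
  assumes B: "1 < B" and r: "0 \<le> r"
    and fin: "\<And>n x h. h \<le> B ^ n \<Longrightarrow> finite (\<Lambda> \<inter> ball x h)"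
    and upper: "\<And>n x h. h \<le> B ^ n \<Longrightarrow> real (card (\<Lambda> \<inter> ball x h)) \<le> f n"
    and lim: "(\<lambda>n. f n / (B powr r) ^ n) \<longlonglongrightarrow> 0"
  shows "upper_beurling_density \<Lambda> r = 0"
proof (rule antisym[OF _ upper_beurling_density_nonneg], rule ereal_le_epsilon2)
  fix e :: real assume e: "0 < e"
  have Br: "B powr r > 0" using B by simp
  \<comment> \<open>Division by \<open>B powr r\<close> pays for the passage from
    \<open>B ^ Suc m\<close> down to \<open>B ^ m\<close>, which is at most
    \<open>h\<close>.\<close>
  have "\<forall>\<^sub>F n in sequentially. f n / (B powr r) ^ n < e / B powr r"
    using e Br by (intro order_tendstoD(2)[OF lim]) simp
  then obtain n0 where n0: "\<And>n. n \<ge> n0 \<Longrightarrow> f n / (B powr r) ^ n < e / B powr r"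
    unfolding eventually_sequentially by meson
  have "(SUP x. ecount (\<Lambda> \<inter> ball x h) / ereal (h powr r)) \<le> ereal e" if h: "h > B ^ n0" for h
  proof (rule SUP_least)
    fix x
    define n where "n = (LEAST n. h \<le> B ^ n)"
    have "\<exists>n. h < B ^ n" using B by (rule real_arch_pow)
    hence "\<exists>n. h \<le> B ^ n" by (meson less_imp_le)
    hence n: "h \<le> B ^ n" unfolding n_def by (rule LeastI_ex)
    have "n0 < n"
    proof (rule ccontr)
      assume "\<not> n0 < n"
      hence "B ^ n \<le> B ^ n0" using B by (intro power_increasing) auto
      thus False using n h by simp
    qed
    then obtain m where m: "n = Suc m" by (cases n) auto
    have "\<not> h \<le> B ^ m" using not_less_Least[of m "\<lambda>n. h \<le> B ^ n"] m by (simp add: n_def)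
    hence "B ^ m \<le> h" by simp
    hence "(B ^ m) powr r \<le> h powr r" using B r by (intro powr_mono2) auto
    moreover have "(B ^ m) powr r = (B powr r) ^ m"
      using B by (simp add: powr_powr mult.commute flip: powr_realpow)
    ultimately have hr: "(B powr r) ^ m \<le> h powr r" by simp
    have "0 < (B powr r) ^ m" using Br by simp
    have "real (card (\<Lambda> \<inter> ball x h)) \<le> f n" by (rule upper[OF n])
    also have "\<dots> \<le> e * (B powr r) ^ m"
      using n0[of n] \<open>n0 < n\<close> Br B unfolding m by (simp add: field_simps)
    also have "\<dots> \<le> e * h powr r" using hr e by simp
    finally have "real (card (\<Lambda> \<inter> ball x h)) / h powr r \<le> e"
      using hr \<open>0 < (B powr r) ^ m\<close> by (subst pos_divide_le_eq) auto
    thus "ecount (\<Lambda> \<inter> ball x h) / ereal (h powr r) \<le> ereal e"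
      using fin[OF n] e hr \<open>0 < (B powr r) ^ m\<close> by (simp add: ecount_def)
  qed
  hence "\<forall>\<^sub>F h in at_top. (SUP x. ecount (\<Lambda> \<inter> ball x h) / ereal (h powr r)) \<le> ereal e"
    by (rule eventually_mono[OF eventually_gt_at_top])
  thus "upper_beurling_density \<Lambda> r \<le> 0 + ereal e"
    unfolding upper_beurling_density_def by (simp add: Limsup_bounded)
qed

text \<open>Many points around one fixed centre, along a geometric sequence of radii, keep both the
  supremum over centres and the upper limit away from zero.\<close>

lemma upper_beurling_density_pos:
  fixes \<Lambda> :: "'a::metric_space set"
  assumes B: "1 < B" and r: "0 \<le> r" and c: "0 < c" and C: "0 < C"
    and fin: "\<And>x h. finite (\<Lambda> \<inter> ball x h)"
    and lower: "\<And>n. c * (B powr r) ^ n \<le> real (card (\<Lambda> \<inter> ball x (C * B ^ n)))"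
  shows "upper_beurling_density \<Lambda> r \<noteq> 0"
proof
  assume "upper_beurling_density \<Lambda> r = 0"
  hence "upper_beurling_density \<Lambda> r < ereal (c / C powr r)" using c C by simp
  hence "\<forall>\<^sub>F h in at_top. (SUP x. ecount (\<Lambda> \<inter> ball x h) / ereal (h powr r)) < ereal (c / C powr r)"
    unfolding upper_beurling_density_def by (rule Limsup_lessD)
  then obtain h0 where h0: "\<And>h. h \<ge> h0 \<Longrightarrow> (SUP x. ecount (\<Lambda> \<inter> ball x h) / ereal (h powr r)) < ereal (c / C powr r)"
    unfolding eventually_at_top_linorder by meson
  obtain n where "h0 / C < B ^ n" using real_arch_pow[OF B] by blast
  hence n: "h0 \<le> C * B ^ n" using C by (simp add: field_simps)
  define h where "h = C * B ^ n"
  have hr: "h powr r = C powr r * (B powr r) ^ n"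
    using B C by (simp add: h_def powr_mult powr_powr mult.commute flip: powr_realpow)
  have pos: "C powr r > 0" "(B powr r) ^ n > 0" using B C by auto
  have hpos: "h powr r > 0" using B C by (simp add: h_def)
  have "c / C powr r = c * (B powr r) ^ n / h powr r" unfolding hr
    using B pos(2) by (intro nonzero_mult_divide_mult_cancel_right[symmetric]) simp
  also have "\<dots> \<le> real (card (\<Lambda> \<inter> ball x h)) / h powr r"
    unfolding h_def by (intro divide_right_mono lower) simp
  finally have "ereal (c / C powr r) \<le> ecount (\<Lambda> \<inter> ball x h) / ereal (h powr r)"
    using fin hpos by (simp add: ecount_def)
  also have "\<dots> \<le> (SUP x. ecount (\<Lambda> \<inter> ball x h) / ereal (h powr r))" by (rule SUP_upper) simp
  also have "\<dots> < ereal (c / C powr r)" using n by (intro h0) (simp add: h_def)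
  finally show False by simp
qed

text \<open>The upper count settles the exponents \<open>r > t\<close>, where
  \<open>(B powr r) ^ n\<close> also absorbs the linear term reserved for the lacunary frequencies;
  the lower count settles \<open>r \<le> t\<close>.\<close>

lemma beurling_dim_eqI:
  fixes \<Lambda> :: "'a::metric_space set"
  assumes B: "1 < B" and t: "0 \<le> t" and c: "0 < c" and C: "0 < C"
    and fin: "\<And>n x h. h \<le> B ^ n \<Longrightarrow> finite (\<Lambda> \<inter> ball x h)"
    and upper: "\<And>n x h. h \<le> B ^ n \<Longrightarrow> real (card (\<Lambda> \<inter> ball x h)) \<le> D * (B powr t) ^ n + n + E"
    and lower: "\<And>n. c * (B powr t) ^ n \<le> real (card (\<Lambda> \<inter> ball x (C * B ^ n)))"
  shows "beurling_dim \<Lambda> = ereal t"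
proof -
  have fin': "finite (\<Lambda> \<inter> ball x h)" for x h
  proof -
    obtain n where "h < B ^ n" using real_arch_pow[OF B] by blast
    thus ?thesis by (intro fin[of h n]) simp
  qed
  have 0: "upper_beurling_density \<Lambda> r = 0" if r: "r > t" for r
  proof (rule upper_beurling_density_eq_0[OF B _ fin upper])
    show "0 \<le> r" using r t by simp
    define a where "a = B powr (t - r)"
    define b where "b = B powr (- r)"
    have "B powr (t - r) < B powr 0" "B powr (- r) < B powr 0"
      using B r t by (intro powr_less_mono; simp)+
    hence ab: "0 < a" "a < 1" "0 < b" "b < 1" using B by (simp_all add: a_def b_def)
    have "(\<lambda>n. D * a ^ n + real n * b ^ n + E * b ^ n) \<longlonglongrightarrow> D * 0 + 0 + E * 0"
      using ab by (intro tendsto_intros LIMSEQ_realpow_zero powser_times_n_limit_0) auto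
    moreover have "a = B powr t / B powr r" "b = 1 / B powr r"
      by (simp_all add: a_def b_def powr_diff powr_minus_divide)
    hence "(D * (B powr t) ^ n + real n + E) / (B powr r) ^ n
        = D * a ^ n + real n * b ^ n + E * b ^ n" for n
      by (simp add: power_divide add_divide_distrib)
    ultimately show "(\<lambda>n. (D * (B powr t) ^ n + real n + E) / (B powr r) ^ n) \<longlonglongrightarrow> 0" by simp
  qed auto
  have pos: "upper_beurling_density \<Lambda> r \<noteq> 0" if r: "0 < r" "r \<le> t" for r
  proof (rule upper_beurling_density_pos[OF B _ c C fin'])
    fix n
    have "(B powr r) ^ n \<le> (B powr t) ^ n" using B r by (intro power_mono powr_mono) auto
    thus "c * (B powr r) ^ n \<le> real (card (\<Lambda> \<inter> ball x (C * B ^ n)))"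
      using c lower[of n] by (meson mult_left_mono less_imp_le order_trans)
  qed (use r in auto)
  have "{r. 0 < r \<and> upper_beurling_density \<Lambda> r = 0} = {t<..}"
    using 0 pos t by (auto simp: not_le[symmetric])
  hence dim: "beurling_dim \<Lambda> = Inf (ereal ` {t<..})" by (simp add: beurling_dim_def)
  show ?thesis unfolding dim
  proof (rule antisym)
    show "Inf (ereal ` {t<..}) \<le> ereal t"
    proof (rule ereal_le_epsilon2)
      fix e :: real assume "0 < e"
      thus "Inf (ereal ` {t<..}) \<le> ereal t + ereal e" by (intro INF_lower2[of "t + e"]) auto
    qed
    show "ereal t \<le> Inf (ereal ` {t<..})" by (intro INF_greatest) auto
  qed
qed

section \<open>Counting numbers with restricted digits\<close>

text \<open>Reads the base 3 expansion of a number in base \<open>b\<close>.\<close>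

fun spread :: "int \<Rightarrow> nat \<Rightarrow> int" where
  "spread b j = (if j = 0 then 0 else int (j mod 3) + b * spread b (j div 3))"

declare spread.simps [simp del]

lemma spread_0 [simp]: "spread b 0 = 0"
  by (simp add: spread.simps)

lemma spread_rec: "spread b j = int (j mod 3) + b * spread b (j div 3)"
  by (cases "j = 0") (simp_all add: spread.simps[of b j])

lemma spread_strict_mono:
  assumes b: "3 \<le> b" and "i < j"
  shows "spread b i < spread b j"
  using \<open>i < j\<close>
proof (induction j arbitrary: i rule: less_induct)
  case (less j)
  have m: "int (i mod 3) \<le> 2" "0 \<le> int (j mod 3)" by simp_all
  show ?case
  proof (cases "i div 3 = j div 3")
    case True
    hence "i mod 3 < j mod 3" using less.prems
      by (metis div_mod_decomp add_less_cancel_left)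
    thus ?thesis using True by (subst (1 2) spread_rec) simp
  next
    case False
    hence "i div 3 < j div 3" using less.prems div_le_mono[of i j 3] by simp
    hence "spread b (i div 3) + 1 \<le> spread b (j div 3)"
      using less.IH[of "j div 3" "i div 3"] less.prems by simp
    hence "b * (spread b (i div 3) + 1) \<le> b * spread b (j div 3)" using b by (intro mult_left_mono) auto
    thus ?thesis using m b by (subst (1 2) spread_rec) (simp add: algebra_simps)
  qed
qed

text \<open>A strictly increasing integer-valued map expands distances. Thus a bound on a difference
  of second coordinates limits the range of the indices.\<close>

lemma spread_diff_ge:
  assumes b: "3 \<le> b" and "i \<le> j"
  shows "int j - int i \<le> spread b j - spread b i"
  using \<open>i \<le> j\<close>
proof (induction j rule: dec_induct)
  case (step j)
  thus ?case using spread_strict_mono[OF b, of j "Suc j"] by simp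
qed simp

lemma spread_split: "spread b j = spread b (j mod 3 ^ n) + b ^ n * spread b (j div 3 ^ n)"
proof (induction n arbitrary: j)
  case (Suc n)
  have "j mod 3 ^ Suc n mod 3 = j mod 3" by (simp add: mod_mod_cancel)
  moreover have "j mod 3 ^ Suc n div 3 = j div 3 mod 3 ^ n"
    by (simp add: mod_mult2_eq)
  ultimately have "spread b (j mod 3 ^ Suc n) = int (j mod 3) + b * spread b (j div 3 mod 3 ^ n)"
    by (subst spread_rec) simp
  moreover have "j div 3 ^ Suc n = j div 3 div 3 ^ n" by (simp add: div_mult2_eq)
  ultimately show ?case using Suc[of "j div 3"] by (subst spread_rec[of b j]) (simp add: algebra_simps)
qed simp

lemma spread_eq_sum:
  "j < 3 ^ n \<Longrightarrow> spread b j = (\<Sum>k<n. b ^ k * int (tdigit k j))"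
proof (induction n arbitrary: j)
  case (Suc n)
  have "tdigit (Suc k) j = tdigit k (j div 3)" for k by (simp add: tdigit_def div_mult2_eq)
  moreover have "j div 3 < 3 ^ n" using Suc.prems by (simp add: less_mult_imp_div_less mult.commute)
  ultimately show ?case
    by (subst spread_rec, subst sum.lessThan_Suc_shift)
      (simp add: Suc.IH sum_distrib_left tdigit_def[of 0] mult_ac)
qed simp

lemma spread_bounds:
  assumes "3 \<le> b" "j < 3 ^ n" shows "0 \<le> spread b j" "spread b j < b ^ n"
proof -
  show "0 \<le> spread b j" using spread_diff_ge[of b 0 j] assms by simp
  show "spread b j < b ^ n" using assms(2)
  proof (induction n arbitrary: j)
    case (Suc n)
    have "j div 3 < 3 ^ n" using Suc.prems by (simp add: less_mult_imp_div_less mult.commute)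
    hence "b * (spread b (j div 3) + 1) \<le> b * b ^ n" using Suc.IH assms(1) by (intro mult_left_mono) force+
    moreover have "int (j mod 3) \<le> 2" by simp
    ultimately show ?case using assms(1) by (subst spread_rec) (simp add: algebra_simps)
  qed simp
qed

section \<open>Numbers whose nonzero digits sit at prescribed positions\<close>

definition digit_set :: "nat set \<Rightarrow> nat set" where
  "digit_set S = {j. \<forall>k. tdigit k j \<noteq> 0 \<longrightarrow> k \<in> S}"

lemma digit_set_mod: "j \<in> digit_set S \<Longrightarrow> j mod 3 ^ n \<in> digit_set S"
  by (auto simp: digit_set_def tdigit_mod)

lemma digit_set_child:
  assumes "i < 3 ^ n" "d < 3"
  shows "i + d * 3 ^ n \<in> digit_set S \<longleftrightarrow> i \<in> digit_set S \<and> (d = 0 \<or> n \<in> S)"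
proof
  assume *: "i + d * 3 ^ n \<in> digit_set S"
  have "(i + d * 3 ^ n) mod 3 ^ n = i" using assms by simp
  hence "i \<in> digit_set S" using digit_set_mod[OF *, of n] by simp
  moreover have "tdigit n (i + d * 3 ^ n) \<noteq> 0 \<longrightarrow> n \<in> S"
    using * unfolding digit_set_def by blast
  hence "d = 0 \<or> n \<in> S" unfolding tdigit_add_top[OF assms] by blast
  ultimately show "i \<in> digit_set S \<and> (d = 0 \<or> n \<in> S)" by blast
next
  assume i: "i \<in> digit_set S \<and> (d = 0 \<or> n \<in> S)"
  show "i + d * 3 ^ n \<in> digit_set S"
    unfolding digit_set_def
  proof (intro CollectI allI impI)
    fix k assume nz: "tdigit k (i + d * 3 ^ n) \<noteq> 0"
    have "d * 3 ^ n \<le> 2 * 3 ^ n" using assms(2) by (intro mult_right_mono) auto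
    hence "i + d * 3 ^ n < 3 ^ Suc n" unfolding power_Suc using assms(1) by linarith
    hence "k \<le> n" using nz tdigit_eq_0[of "i + d * 3 ^ n" "Suc n" k] by (meson not_less_eq_eq)
    thus "k \<in> S"
      using i nz tdigit_add_low[of k n i d] tdigit_add_top[OF assms]
      by (cases "k = n") (auto simp: digit_set_def)
  qed
qed

lemma card_digit_set: "card {j \<in> digit_set S. j < 3 ^ n} = 3 ^ card (S \<inter> {..<n})"
proof -
  have card: "card {j \<in> digit_set S. j < 3 ^ n} = (\<Sum>j<3 ^ n. of_bool (j \<in> digit_set S))" for n
    by (simp add: sum.If_cases of_bool_def Int_def conj_commute)
  have "(\<Sum>j<3 ^ n. of_bool (j \<in> digit_set S)) = (3::nat) ^ card (S \<inter> {..<n})"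
  proof (induction n)
    case 0
    show ?case by (simp add: digit_set_def tdigit_def)
  next
    case (Suc n)
    have "(\<Sum>j<3 ^ Suc n. of_bool (j \<in> digit_set S))
        = (\<Sum>i<3 ^ n. \<Sum>d<3::nat. of_bool (i \<in> digit_set S) * of_bool (d = 0 \<or> n \<in> S) :: nat)"
      unfolding sum_lessThan_power3_Suc
      by (intro sum.cong refl) (simp add: digit_set_child)
    also have "\<dots> = (\<Sum>i<3 ^ n. of_bool (i \<in> digit_set S) * (if n \<in> S then 3 else 1))"
    proof (intro sum.cong refl)
      show "(\<Sum>d<3::nat. of_bool b * of_bool (d = 0 \<or> n \<in> S)) = (of_bool b * (if n \<in> S then 3 else 1) :: nat)" for b
        by (simp add: numeral_3_eq_3)
    qed
    also have "\<dots> = 3 ^ card (S \<inter> {..<n}) * (if n \<in> S then 3 else 1)"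
      unfolding sum_distrib_right[symmetric] Suc ..
    also have "\<dots> = 3 ^ card (S \<inter> {..<Suc n})"
      by (simp add: lessThan_Suc Int_insert_right)
    finally show ?case .
  qed
  thus ?thesis by (simp only: card)
qed

text \<open>Take the positions at which the floor of \<open>\<alpha> * k\<close> increases. For
  \<alpha> at most 1 each increase is by one, so the count telescopes to the floor itself.\<close>

lemma exists_set_with_density:
  fixes \<alpha> :: real
  assumes "0 \<le> \<alpha>" "\<alpha> \<le> 1"
  obtains S :: "nat set" where "\<And>n. card (S \<inter> {..<n}) = nat \<lfloor>\<alpha> * n\<rfloor>"
proof
  define S where "S = {k::nat. \<lfloor>\<alpha> * Suc k\<rfloor> \<noteq> \<lfloor>\<alpha> * k\<rfloor>}"
  fix n
  show "card (S \<inter> {..<n}) = nat \<lfloor>\<alpha> * n\<rfloor>"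
  proof (induction n)
    case (Suc n)
    define a where "a = \<lfloor>\<alpha> * n\<rfloor>"
    define b where "b = \<lfloor>\<alpha> * Suc n\<rfloor>"
    have "a \<le> b" "b \<le> \<lfloor>\<alpha> * n + 1\<rfloor>" unfolding a_def b_def
      using assms by (intro floor_mono; simp add: algebra_simps)+
    moreover have "0 \<le> a" using assms by (simp add: a_def)
    moreover have "n \<in> S \<longleftrightarrow> b \<noteq> a" by (simp add: S_def a_def b_def)
    moreover have "card (S \<inter> {..<Suc n}) = (if n \<in> S then Suc (nat a) else nat a)"
      using Suc by (simp add: lessThan_Suc Int_insert_right a_def)
    ultimately have "card (S \<inter> {..<Suc n}) = nat b" by (auto simp flip: a_def)
    thus ?case by (simp only: b_def)
  qed simp
qed

section \<open>The dimension of the spectrum\<close>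

locale sierpinski_digits = sierpinski_measure q1 q2 "digit_set S" M for q1 q2 S M +
  assumes q12: "q1 \<le> q2"
begin

text \<open>All ancestors \<open>j mod 3 ^ k\<close> of a member are members, so no shift occurs
  along its path and only the digits contribute.\<close>

lemma ly_digit_set:
  assumes "j \<in> digit_set S" shows "ly j = q2 * spread b2 j"
proof -
  have "j < 3 ^ Suc j" using less_power3[of "Suc j"] by linarith
  hence "spread b2 j = (\<Sum>k<Suc j. b2 ^ k * int (tdigit k j))" by (rule spread_eq_sum)
  moreover have "jump k (j mod 3 ^ k) = 0" for k
    using digit_set_mod[OF assms, of k] by (simp add: jump_def)
  ultimately show ?thesis
    by (simp add: ly_def ys_def sum_distrib_left mult_ac del: sum.lessThan_Suc)
qed

lemma ly_not_digit_set:
  assumes "j \<notin> digit_set S" shows "b2 ^ j \<le> ly j" "2 * ly j \<le> 5 * b2 ^ j"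
  using assms ly_eq[OF less_power3, of j] ys_bound[of j j] ys_nonneg[of j j] by auto

text \<open>Lacunarity: outside \<open>digit_set S\<close> the shift dominates, and
  \<open>ly j\<close> lies between 1 and 5/2 times \<open>b2 ^ j\<close>. With
  \<open>X = b2 ^ (j - 1)\<close> this gives \<open>ly j\<close> at least 3 \<open>X\<close> and
  \<open>ly i\<close> at most 5/2 \<open>X\<close>.\<close>

lemma ly_gap:
  assumes "i < j" "i \<notin> digit_set S" "j \<notin> digit_set S"
  shows "b2 ^ (j - 1) \<le> 2 * (ly j - ly i)"
proof -
  define X where "X = b2 ^ (j - 1)"
  have "b2 ^ i \<le> X" unfolding X_def using assms(1) b2_ge by (intro power_increasing) auto
  hence "5 * b2 ^ i \<le> 5 * X" by (intro mult_left_mono) auto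
  hence i: "2 * ly i \<le> 5 * X" using ly_not_digit_set(2)[OF assms(2)] by (rule order_trans[rotated])
  have "3 * X \<le> b2 ^ j"
  proof -
    have "3 * X \<le> b2 * X" unfolding X_def using b2_ge by (intro mult_right_mono) auto
    also have "\<dots> = b2 ^ j" unfolding X_def using assms(1) by (cases j) auto
    finally show ?thesis .
  qed
  hence "3 * X \<le> ly j" using ly_not_digit_set(1)[OF assms(3)] by (rule order_trans)
  hence "X \<le> 2 * (ly j - ly i)" using i by presburger
  thus ?thesis by (simp only: X_def)
qed

section \<open>Counting the frequencies in a ball\<close>

context
  fixes n :: nat and x :: "real \<times> real" and h :: real
  assumes h: "h \<le> real_of_int b2 ^ n"
begin

lemma ly_near:
  assumes "lam i \<in> ball x h" "lam j \<in> ball x h"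
  shows "ly j - ly i < 2 * b2 ^ n"
proof -
  have "dist (lam j) (lam i) < h + h"
    using assms dist_triangle_less_add[of "lam j" x h "lam i" h] by (simp add: dist_commute)
  moreover have "dist (snd (lam j)) (snd (lam i)) \<le> dist (lam j) (lam i)" by (rule dist_snd_le)
  ultimately have "real_of_int (ly j - ly i) < real_of_int (2 * b2 ^ n)"
    using h by (simp add: lam_def dist_real_def)
  thus ?thesis by (simp only: of_int_less_iff)
qed

text \<open>An index is split into its lowest \<open>n\<close> digits and the rest. The low part is
  one of \<open>3 ^ card (S \<inter> {..<n})\<close> numbers; the high part varies in a window of
  length 3, because the second coordinates in the ball differ by less than
  \<open>2 * b2 ^ n\<close>.\<close>

lemma card_digit_set_ball:
  "finite {j \<in> digit_set S. lam j \<in> ball x h}"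
  "card {j \<in> digit_set S. lam j \<in> ball x h} \<le> 3 ^ card (S \<inter> {..<n}) * 3"
proof -
  let ?I = "{j \<in> digit_set S. lam j \<in> ball x h}"
  obtain m where m: "\<And>j. j \<in> ?I \<Longrightarrow> j div 3 ^ n \<in> {m..m + 2}"
  proof (cases "?I = {}")
    case False
    then obtain j0 where "j0 \<in> ?I" by blast
    then obtain i where i: "i \<in> ?I" "\<And>j. j \<in> ?I \<Longrightarrow> i div 3 ^ n \<le> j div 3 ^ n"
      using ex_has_least_nat[of "\<lambda>j. j \<in> ?I" j0 "\<lambda>j. j div 3 ^ n"] by blast
    have "j div 3 ^ n \<in> {i div 3 ^ n..i div 3 ^ n + 2}" if j: "j \<in> ?I" for j
    proof -
      have "ly j - ly i < 2 * b2 ^ n" using i j by (intro ly_near) auto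
      hence "q2 * (spread b2 j - spread b2 i) < 2 * b2 ^ n"
        using i j by (simp add: ly_digit_set algebra_simps)
      moreover have "spread b2 j - spread b2 i \<le> q2 * (spread b2 j - spread b2 i)"
        if "0 \<le> spread b2 j - spread b2 i"
        using mult_right_mono[OF q2 that] by simp
      moreover have "0 < b2 ^ n" using b2_ge by simp
      ultimately have "spread b2 j - spread b2 i < 2 * b2 ^ n" by linarith
      moreover have "0 \<le> spread b2 (j mod 3 ^ n)" "spread b2 (i mod 3 ^ n) < b2 ^ n"
        using spread_bounds[OF b2_ge, of _ n] by auto
      \<comment> \<open>Two multiples of \<open>b2 ^ n\<close> come from the diameter of the ball,
        the third from the low digits of \<open>i\<close>.\<close>
      ultimately have "b2 ^ n * (spread b2 (j div 3 ^ n) - spread b2 (i div 3 ^ n)) < b2 ^ n * 3"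
        using spread_split[of b2 j n] spread_split[of b2 i n] by (simp add: right_diff_distrib)
      hence "spread b2 (j div 3 ^ n) - spread b2 (i div 3 ^ n) < 3" using b2_ge by simp
      moreover have ge: "i div 3 ^ n \<le> j div 3 ^ n" using i(2)[OF j] .
      ultimately have "int (j div 3 ^ n) - int (i div 3 ^ n) < 3"
        using spread_diff_ge[OF b2_ge ge] by linarith
      thus ?thesis using ge by simp
    qed
    thus ?thesis by (rule that)
  next
    case True
    thus ?thesis using that[of 0] by blast
  qed
  define T where "T = {i \<in> digit_set S. i < 3 ^ n} \<times> {m..m + 2}"
  define g where "g j = (j mod 3 ^ n, j div 3 ^ n)" for j :: nat
  have "finite {i \<in> digit_set S. i < 3 ^ n}" by (rule finite_subset[of _ "{..<3 ^ n}"]) auto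
  hence T: "finite T" "card T = 3 ^ card (S \<inter> {..<n}) * 3"
    by (simp_all add: T_def card_cartesian_product card_digit_set)
  have g: "inj_on g ?I" "g ` ?I \<subseteq> T"
    using m digit_set_mod by (auto simp: g_def T_def inj_on_def) (metis mod_div_mult_eq)
  show "finite ?I" using g T(1) by (meson finite_imageD finite_subset)
  show "card ?I \<le> 3 ^ card (S \<inter> {..<n}) * 3"
    using card_inj_on_le[OF g T(1)] T(2) by simp
qed

text \<open>Let \<open>i\<close> be the least such index. By \<open>ly_gap\<close> any other
  \<open>j\<close> satisfies \<open>b2 ^ (j - 1) < 4 * b2 ^ n\<close>, and \<open>b2 * b2\<close>
  exceeds 4, so \<open>j\<close> is one of the \<open>n + 3\<close> numbers up to
  \<open>n + 2\<close>.\<close>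

lemma card_not_digit_set_ball:
  "finite {j. j \<notin> digit_set S \<and> lam j \<in> ball x h}"
  "card {j. j \<notin> digit_set S \<and> lam j \<in> ball x h} \<le> n + 4"
proof -
  let ?I = "{j. j \<notin> digit_set S \<and> lam j \<in> ball x h}"
  have "\<exists>i. ?I \<subseteq> insert i {..n + 2}"
  proof (cases "?I = {}")
    case False
    then obtain j0 where "j0 \<in> ?I" by blast
    then obtain i where i: "i \<in> ?I" "\<And>j. j \<in> ?I \<Longrightarrow> i \<le> j"
      using ex_has_least_nat[of "\<lambda>j. j \<in> ?I" j0 "\<lambda>j. j"] by blast
    have "j \<le> n + 2" if j: "j \<in> ?I" "j \<noteq> i" for j
    proof (rule ccontr)
      assume "\<not> j \<le> n + 2"
      hence "b2 ^ (n + 2) \<le> b2 ^ (j - 1)" using b2_ge by (intro power_increasing) auto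
      also have "\<dots> \<le> 2 * (ly j - ly i)" using i j by (intro ly_gap) (auto simp: le_neq_implies_less)
      also have "\<dots> < 4 * b2 ^ n" using ly_near[of i j] i(1) j(1) by simp
      finally have "b2 ^ n * (b2 * b2) < b2 ^ n * 4" by (simp add: mult_ac)
      hence "b2 * b2 < 4" using b2_ge by simp
      moreover have "3 * 3 \<le> b2 * b2" using b2_ge by (intro mult_mono) auto
      ultimately show False by linarith
    qed
    thus ?thesis by (intro exI[of _ i]) blast
  next
    case True
    thus ?thesis by blast
  qed
  then obtain i where i: "?I \<subseteq> insert i {..n + 2}" ..
  show "finite ?I" by (rule finite_subset[OF i]) simp
  have "card ?I \<le> card (insert i {..n + 2})" by (rule card_mono[OF _ i]) simp
  also have "\<dots> \<le> n + 4" by (rule order_trans[OF card_insert_le_m1]) auto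
  finally show "card ?I \<le> n + 4" .
qed

lemma card_range_lam_ball:
  "finite (range lam \<inter> ball x h)"
  "card (range lam \<inter> ball x h) \<le> 3 ^ card (S \<inter> {..<n}) * 3 + (n + 4)"
proof -
  have split: "range lam \<inter> ball x h = lam ` ({j \<in> digit_set S. lam j \<in> ball x h}
      \<union> {j. j \<notin> digit_set S \<and> lam j \<in> ball x h})" by blast
  show "finite (range lam \<inter> ball x h)"
    unfolding split using card_digit_set_ball(1) card_not_digit_set_ball(1) by blast
  have "card (range lam \<inter> ball x h) \<le> card ({j \<in> digit_set S. lam j \<in> ball x h}
      \<union> {j. j \<notin> digit_set S \<and> lam j \<in> ball x h})"
    unfolding split using card_digit_set_ball(1) card_not_digit_set_ball(1) by (intro card_image_le) blast
  also have "\<dots> \<le> 3 ^ card (S \<inter> {..<n}) * 3 + (n + 4)"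
    by (rule order_trans[OF card_Un_le add_mono[OF card_digit_set_ball(2) card_not_digit_set_ball(2)]])
  finally show "card (range lam \<inter> ball x h) \<le> 3 ^ card (S \<inter> {..<n}) * 3 + (n + 4)" .
qed

end

lemma card_range_lam_ball_ge:
  "3 ^ card (S \<inter> {..<n}) \<le> card (range lam \<inter> ball 0 (3 * real_of_int b2 ^ n))"
proof -
  have pos: "0 < real_of_int b2 ^ n" using b2_ge by simp
  have sub: "lam ` {j \<in> digit_set S. j < 3 ^ n} \<subseteq> range lam \<inter> ball 0 (3 * real_of_int b2 ^ n)"
  proof (rule subsetI)
    fix l assume "l \<in> lam ` {j \<in> digit_set S. j < 3 ^ n}"
    then obtain j where l: "l = lam j" and j: "j \<in> digit_set S" "j < 3 ^ n" by blast
    \<comment> \<open>Here \<open>q1 \<le> q2\<close> enters: the second coordinate sets the scale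
      of the ball.\<close>
    have "b1 ^ n \<le> b2 ^ n" using q1 q12 by (intro power_mono) (auto simp: b1_def b2_def)
    hence "2 * \<bar>lx j\<bar> \<le> b2 ^ n" using xs_bound[of n j] lx_eq[OF j(2)] by simp
    hence x: "2 * \<bar>real_of_int (lx j)\<bar> \<le> real_of_int b2 ^ n" by (simp flip: of_int_power)
    have "0 \<le> ly j" "2 * ly j \<le> 3 * b2 ^ n"
      using ys_bound[of n j] ys_nonneg[of n j] ly_eq[OF j(2)] j(1) by auto
    hence y: "2 * \<bar>real_of_int (ly j)\<bar> \<le> 3 * real_of_int b2 ^ n" by (simp flip: of_int_power)
    \<comment> \<open>The coordinates contribute at most 1/2 and 3/2 times \<open>b2 ^ n\<close>, so
      the norm is at most \<open>2 * b2 ^ n\<close>.\<close>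
    have "norm (lam j) \<le> \<bar>real_of_int (lx j)\<bar> + \<bar>real_of_int (ly j)\<bar>"
      unfolding lam_def using norm_Pair_le[of "real_of_int (lx j)" "real_of_int (ly j)"] by simp
    hence "lam j \<in> ball 0 (3 * real_of_int b2 ^ n)" using x y pos by (simp add: dist_norm)
    thus "l \<in> range lam \<inter> ball 0 (3 * real_of_int b2 ^ n)" by (simp add: l)
  qed
  have "3 ^ card (S \<inter> {..<n}) = card (lam ` {j \<in> digit_set S. j < 3 ^ n})"
    by (subst card_image) (auto intro: inj_on_subset[OF inj_lam] simp: card_digit_set)
  also have "\<dots> \<le> card (range lam \<inter> ball 0 (3 * real_of_int b2 ^ n))"
  proof (rule card_mono[OF _ sub])
    obtain m where "3 * real_of_int b2 ^ n < real_of_int b2 ^ m"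
      using real_arch_pow[of "real_of_int b2" "3 * real_of_int b2 ^ n"] b2_ge by auto
    thus "finite (range lam \<inter> ball 0 (3 * real_of_int b2 ^ n))"
      by (intro card_range_lam_ball(1)[of _ m]) simp
  qed
  finally show ?thesis .
qed

text \<open>The density \<open>\<alpha> = t * ln b2 / ln 3\<close> is tuned so that 3 to the power
  \<open>\<alpha> * n\<close> equals \<open>b2\<close> to the power \<open>t * n\<close>; rounding
  the exponent down loses at most a factor 3.\<close>

lemma beurling_dim_range_lam:
  assumes t: "0 \<le> t"
    and S: "\<And>n. card (S \<inter> {..<n}) = nat \<lfloor>t * ln (real_of_int b2) / ln 3 * n\<rfloor>"
  shows "beurling_dim (range lam) = ereal t"
proof -
  define B where "B = real_of_int b2"
  have B: "1 < B" using b2_ge by (simp add: B_def)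
  define \<alpha> where "\<alpha> = t * ln B / ln 3"
  have \<alpha>: "0 \<le> \<alpha>" using t B by (simp add: \<alpha>_def)
  have pw: "3 powr (\<alpha> * n) = (B powr t) ^ n" for n :: nat
    using B by (simp add: powr_def \<alpha>_def mult_ac flip: exp_of_nat_mult)
  have N: "real (nat \<lfloor>\<alpha> * n\<rfloor>) \<le> \<alpha> * n" "\<alpha> * n < real (nat \<lfloor>\<alpha> * n\<rfloor>) + 1" for n :: nat
    using \<alpha> by (auto simp: of_nat_nat)
  have S': "(3::real) ^ card (S \<inter> {..<n}) = 3 powr real (nat \<lfloor>\<alpha> * n\<rfloor>)" for n
    using S[of n] by (simp add: powr_realpow \<alpha>_def B_def)
  have up: "(3::real) ^ card (S \<inter> {..<n}) \<le> (B powr t) ^ n" for n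
    unfolding S' pw[symmetric] by (rule powr_mono) (use N in auto)
  have lo: "(B powr t) ^ n / 3 \<le> (3::real) ^ card (S \<inter> {..<n})" for n
  proof -
    have "(B powr t) ^ n \<le> 3 powr (real (nat \<lfloor>\<alpha> * n\<rfloor>) + 1)"
      unfolding pw[symmetric] by (rule powr_mono) (use N(2)[of n] in auto)
    thus ?thesis unfolding S' by (simp add: powr_add)
  qed
  show ?thesis
  proof (rule beurling_dim_eqI[OF B t, of "1/3" 3 _ 3 4 0])
    fix n :: nat and x and h :: real assume h: "h \<le> B ^ n"
    show "finite (range lam \<inter> ball x h)" using h unfolding B_def by (rule card_range_lam_ball)
    have "real (card (range lam \<inter> ball x h)) \<le> real (3 ^ card (S \<inter> {..<n}) * 3 + (n + 4))"
      unfolding of_nat_le_iff using h unfolding B_def by (rule card_range_lam_ball)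
    thus "real (card (range lam \<inter> ball x h)) \<le> 3 * (B powr t) ^ n + real n + 4"
      using up[of n] by simp
  next
    fix n
    have "(3::real) ^ card (S \<inter> {..<n}) \<le> real (card (range lam \<inter> ball 0 (3 * B ^ n)))"
      using card_range_lam_ball_ge[of n] unfolding B_def by (metis of_nat_le_iff of_nat_numeral of_nat_power)
    thus "1 / 3 * (B powr t) ^ n \<le> real (card (range lam \<inter> ball 0 (3 * B ^ n)))"
      using lo[of n] by linarith
  qed auto
qed

end

theorem theorem1p4:
  fixes q1 q2 :: int and \<mu> :: "(real \<times> real) measure" and t :: real
  assumes "1 \<le> q1" and "q1 \<le> q2"
    and "self_affine_measure (sier_A q1 q2) sier_D \<mu>"
    and "0 \<le> t" and "t \<le> ln 3 / ln (3 * real_of_int q2)"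
  shows "uncountable {\<Lambda>. is_spectrum \<mu> \<Lambda> \<and> beurling_dim \<Lambda> = ereal t}"
proof -
  have "0 < ln (3 * real_of_int q2)" using assms(1,2) by (intro ln_gt_zero) auto
  \<comment> \<open>The upper bound on \<open>t\<close> says exactly that the required density of
    digit positions is at most 1.\<close>
  hence "0 \<le> t * ln (3 * real_of_int q2) / ln 3" "t * ln (3 * real_of_int q2) / ln 3 \<le> 1"
    using assms(4,5) by (simp_all add: pos_le_divide_eq)
  then obtain S :: "nat set" where S: "\<And>n. card (S \<inter> {..<n}) = nat \<lfloor>t * ln (3 * real_of_int q2) / ln 3 * n\<rfloor>"
    by (rule exists_set_with_density) blast
  interpret sierpinski_digits q1 q2 S \<mu>
    by unfold_locales (use assms in auto)
  have "beurling_dim (range lam) = ereal t"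
    using S assms(4) by (intro beurling_dim_range_lam) (simp_all add: b2_def)
  thus ?thesis
    using uncountable_spectra_if_spectrum[OF sets_M spectrum_range_lam] by simp
qed

end
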